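(* Let $\{S_n\}_{n\ge 0}$ be either (a) simple random walk, started at a fixed vertex $e$, on a countably infinite, connected, vertex transitive graph $\mathcal G$ all of whose vertices have the same finite degree $\mathcal D$; or (b) the right random walk $S_n = X_1X_2\cdots X_n$ ($S_0=e$ the identity) on a Cayley graph $(G,\mathcal S)$ of an infinite group $G$ generated by a finite set $\mathcal S=\{g_1,\dots,g_s,g_1^{-1},\dots,g_s^{-1}\}$, where the step weights satisfy $\alpha_i=\alpha_{s+i}$ for $1\le i\le s$ and $\alpha_i>0$ for all $i$. Let $\rho$ be the radius of convergence of the power series $U(z)=\sum_{n=0}^\infty u_nz^n$ and let $F(z)=\sum_{n=1}^\infty f_nz^n$. Then $$1\le\rho<\infty,\qquad \lim_{n\to\infty}[u_{pn}]^{1/(pn)}=\frac1\rho\qquad\text{and}\qquad F(\rho)\le1 .$$ If, moreover, $$\text{for all } 0<\eta<1,\quad \limsup_{n\to\infty,\;p\mid n}\ \sup_{1\le r<(1-\eta)n,\;p\mid r}\frac{u_{n-r}}{\rho^r u_n}<\infty,$$ and $$\text{for each fixed } r \text{ with } p\mid r,\quad \lim_{n\to\infty,\;p\mid n}\frac{u_{n-r}}{\rho^r u_n}=1,$$ then for all $\varepsilon>0$ $$\lim_{n\to\infty}P\Big\{\Big|\tfrac1{pn}R_{pn}-\big(1-F(\rho)\big)\Big|>\varepsilon\,\Big|\,\mathcal E_{pn}\Big\}=0 .$$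
   Context: A countable graph is vertex transitive if for any two vertices $v',v''$ there is a graph automorphism mapping $v'$ to $v''$. Simple random walk on $\mathcal G$ is the Markov chain with $P\{S_{n+1}=w\mid S_n=v\}=1/\mathcal D$ if $w$ is a neighbor of $v$ and $0$ otherwise. Cayley graph $(G,\mathcal S)$: vertices are the elements of $G$, with an edge between $v'$ and $v''$ iff $v''=v'g_i$ or $v''=v'g_i^{-1}$ for some $1\le i\le s$. Random walk on $(G,\mathcal S)$: given $\alpha_i\ge0$, $1\le i\le 2s$, with $\sum_{i=1}^{2s}\alpha_i=1$, let $X,X_1,X_2,\dots$ be i.i.d. $G$-valued with law giving weight $\alpha_i$ to $g_i$ and $\alpha_{s+i}$ to $g_i^{-1}$ ($1\le i\le s$; weights of coinciding elements are added), and $S_n=X_1\cdots X_n$. Notation: $\mathcal E_n=\{S_n=e\}$; $u_n=P\{\mathcal E_n\}$; $f_n=P\{S_k\ne e \text{ for } 1\le k\le n-1,\ S_n=e\}$ for $n\ge1$; $R_n=|\{S_0,S_1,\dots,S_{n-1}\}|$ (the range). The period is $p=\gcd\{n\ge1:u_n>0\}$, which is $1$ or $2$. Limits with the restriction $p\mid n$ are taken along multiples $n$ of $p$ (for which $u_n>0$ once $n$ is large). *)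

theory Defs
  imports "HOL-Probability.Probability" "HOL-Algebra.Generated_Groups"
begin

definition graph_automorphism :: "'v set \<Rightarrow> ('v \<Rightarrow> 'v \<Rightarrow> bool) \<Rightarrow> ('v \<Rightarrow> 'v) \<Rightarrow> bool" where
  "graph_automorphism V adj \<phi> \<longleftrightarrow>
     bij_betw \<phi> V V \<and> (\<forall>v\<in>V. \<forall>w\<in>V. adj (\<phi> v) (\<phi> w) \<longleftrightarrow> adj v w)"

text \<open>
  Graphs are undirected and without multiple edges. A loop \<open>adj v v\<close> is not excluded; it
  makes \<open>v\<close> one of its own neighbours and counts once in the degree.
\<close>

locale transitive_graph =
  fixes V :: "'v set" and adj :: "'v \<Rightarrow> 'v \<Rightarrow> bool" and D :: nat
  assumes adj_closed: "adj v w \<Longrightarrow> v \<in> V \<and> w \<in> V"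
    and adj_sym: "adj v w \<Longrightarrow> adj w v"
    and countable_vertices: "countable V"
    and infinite_vertices: "infinite V"
    and connected_graph: "v \<in> V \<Longrightarrow> w \<in> V \<Longrightarrow> adj\<^sup>*\<^sup>* v w"
    and finite_neighbours: "v \<in> V \<Longrightarrow> finite {w. adj v w}"
    and degree: "v \<in> V \<Longrightarrow> card {w. adj v w} = D"
    and vertex_transitive:
      "v \<in> V \<Longrightarrow> w \<in> V \<Longrightarrow> \<exists>\<phi>. graph_automorphism V adj \<phi> \<and> \<phi> v = w"

text \<open>
  \<open>cond_prob\<close> is \<open>0\<close> when the conditioning event is null, so the Markov property is
  required only for histories of positive probability.
\<close>

locale simple_random_walk = prob_space M + transitive_graph V adj D
  for M :: "'w measure" and V :: "'v set" and adj :: "'v \<Rightarrow> 'v \<Rightarrow> bool" and D :: nat +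
  fixes e :: 'v and S :: "nat \<Rightarrow> 'w \<Rightarrow> 'v"
  assumes start_vertex: "e \<in> V"
    and measurable_walk: "\<And>n. S n \<in> measurable M (count_space V)"
    and start: "AE \<omega> in M. S 0 \<omega> = e"
    and markov: "\<And>n x w. w \<in> V \<Longrightarrow> \<P>(\<omega> in M. \<forall>k\<le>n. S k \<omega> = x k) > 0 \<Longrightarrow>
      \<P>(\<omega> in M. S (Suc n) \<omega> = w \<bar> \<forall>k\<le>n. S k \<omega> = x k) =
        (if adj (x n) w then 1 / real D else 0)"

text \<open>
  The generators are \<open>g 1, \<dots>, g s\<close> and their inverses, possibly with repetitions; \<open>\<alpha> i\<close> is
  the weight of \<open>g i\<close> and \<open>\<alpha> (s + i)\<close> that of its inverse. The steps are \<open>X 1, X 2, \<dots>\<close>.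
\<close>

locale symmetric_group_steps = prob_space M + group G
  for M :: "'w measure" and G :: "('v, 'm) monoid_scheme" (structure) +
  fixes s :: nat and g :: "nat \<Rightarrow> 'v" and \<alpha> :: "nat \<Rightarrow> real" and X :: "nat \<Rightarrow> 'w \<Rightarrow> 'v"
  assumes infinite_group: "infinite (carrier G)"
    and generators_closed: "g ` {1..s} \<subseteq> carrier G"
    and generating: "generate G (g ` {1..s} \<union> (\<lambda>i. inv\<^bsub>G\<^esub> (g i)) ` {1..s}) = carrier G"
    and weights_pos: "\<And>i. i \<in> {1..2 * s} \<Longrightarrow> \<alpha> i > 0"
    and weights_sum: "(\<Sum>i = 1..2 * s. \<alpha> i) = 1"
    and weights_sym: "\<And>i. i \<in> {1..s} \<Longrightarrow> \<alpha> i = \<alpha> (s + i)"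
    and steps_indep: "indep_vars (\<lambda>_. count_space (carrier G)) X {1..}"
    and steps_law: "\<And>n x. n \<ge> 1 \<Longrightarrow> x \<in> carrier G \<Longrightarrow>
      \<P>(\<omega> in M. X n \<omega> = x) =
        (\<Sum>i | i \<in> {1..s} \<and> g i = x. \<alpha> i) +
        (\<Sum>i | i \<in> {1..s} \<and> inv\<^bsub>G\<^esub> (g i) = x. \<alpha> (s + i))"

primrec right_walk :: "('v, 'm) monoid_scheme \<Rightarrow> (nat \<Rightarrow> 'w \<Rightarrow> 'v) \<Rightarrow> nat \<Rightarrow> 'w \<Rightarrow> 'v" where
  "right_walk G X 0 = (\<lambda>\<omega>. \<one>\<^bsub>G\<^esub>)"
| "right_walk G X (Suc n) = (\<lambda>\<omega>. right_walk G X n \<omega> \<otimes>\<^bsub>G\<^esub> X (Suc n) \<omega>)"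

definition return_prob :: "'w measure \<Rightarrow> (nat \<Rightarrow> 'w \<Rightarrow> 'v) \<Rightarrow> 'v \<Rightarrow> nat \<Rightarrow> real" where
  "return_prob M S e n = \<P>(\<omega> in M. S n \<omega> = e)"

text \<open>Only meaningful for \<open>n \<ge> 1\<close>.\<close>

definition first_return_prob :: "'w measure \<Rightarrow> (nat \<Rightarrow> 'w \<Rightarrow> 'v) \<Rightarrow> 'v \<Rightarrow> nat \<Rightarrow> real" where
  "first_return_prob M S e n = \<P>(\<omega> in M. (\<forall>k\<in>{1..n - 1}. S k \<omega> \<noteq> e) \<and> S n \<omega> = e)"

definition walk_period :: "'w measure \<Rightarrow> (nat \<Rightarrow> 'w \<Rightarrow> 'v) \<Rightarrow> 'v \<Rightarrow> nat" where
  "walk_period M S e = Gcd {n. n \<ge> 1 \<and> return_prob M S e n > 0}"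

definition walk_range :: "(nat \<Rightarrow> 'w \<Rightarrow> 'v) \<Rightarrow> nat \<Rightarrow> 'w \<Rightarrow> nat" where
  "walk_range S n \<omega> = card ((\<lambda>k. S k \<omega>) ` {..<n})"

text \<open>The filter of \<open>n \<rightarrow> \<infinity>\<close> along the multiples of \<open>p\<close>.\<close>

definition multiples_at_top :: "nat \<Rightarrow> nat filter" where
  "multiples_at_top p = inf sequentially (principal {n. p dvd n})"

end

theory Submission
  imports Defs
begin

text \<open>
  Both walks are Markov chains with a symmetric kernel that looks the same from every vertex:
  graph automorphisms, respectively left translations, carry \<open>e\<close> to any other vertex. For such a
  chain a path that makes a first return loop of length \<open>r\<close> at some time can be cut: deleting the
  loop leaves a path of the same chain, and the loop contributes the factor \<open>f r\<close>, independently of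
  where it is attached (\<open>loop_excision\<close>). Hence the probability that the walk makes a first return
  loop of length \<open>r\<close> from time \<open>k\<close> on and is at \<open>e\<close> at time \<open>n\<close> is \<open>f r * u (n - r)\<close>, and two loops
  over disjoint time intervals give \<open>f r * f q * u (n - r - q)\<close>.

  The case of a single loop at time \<open>0\<close> yields the renewal equation, equivalent to
  \<open>F(z) U(z) = U(z) - 1\<close> inside the disc of convergence, and therefore \<open>F(\<rho>) \<le> 1\<close>. Concatenation
  of loops gives \<open>u m * u n \<le> u (m + n)\<close>, from which the existence of the limit of the roots follows
  as in Fekete's lemma; reversing the first step shows \<open>u 2 > 0\<close> and thus \<open>\<rho> < \<infinity>\<close>.

  For the range, \<open>n - R n\<close> is the number of times \<open>k < n\<close> at which the current vertex is visited again
  before time \<open>n\<close>. Conditionally on a return at time \<open>n\<close>, a first return of length \<open>r\<close> from time \<open>k\<close> has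
  probability \<open>f r * u (n - r) / u n\<close>, which is close to \<open>f r * \<rho> ^ r\<close> by the ratio hypothesis, and
  summing over \<open>r\<close> suggests the density \<open>F(\<rho>)\<close> for such times. Loops of unbounded length may overlap
  and then their joint probabilities are not explicit. This is avoided by counting only revisits
  within \<open>L\<close> steps. At distance at least \<open>L\<close> such revisits are asymptotically uncorrelated, so their
  number concentrates around \<open>n\<close> times a partial sum of \<open>F(\<rho>)\<close>. The revisits that are missed need only
  a first moment: the domination hypothesis bounds their expected number by a constant times \<open>n\<close>
  times the tail of \<open>F(\<rho>)\<close>, up to an arbitrarily small proportion of discarded times
  (\<open>bridge_deviation_bound\<close>).
\<close>

section \<open>Renewal sequences and their radius of convergence\<close>

text \<open>
  The numerical properties of return probabilities \<open>u\<close> and first return probabilities \<open>f\<close> from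
  which the statements about the radius of convergence follow. Supermultiplicativity is listed as
  an axiom because it holds for walks for an elementary reason: a loop of length \<open>m\<close> followed by
  one of length \<open>n\<close> is a loop of length \<open>m + n\<close>. That \<open>u 2\<close> is positive reflects that each step
  can be undone; it bounds the radius of convergence and restricts the period to \<open>1\<close> or \<open>2\<close>.
\<close>

locale renewal_sequence =
  fixes u f :: "nat \<Rightarrow> real"
  assumes u_0: "u 0 = 1"
    and u_nonneg: "u n \<ge> 0"
    and u_le_1: "u n \<le> 1"
    and u_supermult: "u m * u n \<le> u (m + n)"
    and u_2_pos: "u 2 > 0"
    and f_nonneg: "f n \<ge> 0"
    and renewal: "n \<ge> 1 \<Longrightarrow> u n = (\<Sum>r = 1..n. f r * u (n - r))"
begin

definition period :: nat where "period = Gcd {n. n \<ge> 1 \<and> u n > 0}"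
definition \<rho> :: real where "\<rho> = real_of_ereal (conv_radius u)"

lemma u_power_le: "u m ^ k \<le> u (m * k)"
proof (induction k)
  case 0
  then show ?case by (simp add: u_0)
next
  case (Suc k)
  have "u m ^ Suc k \<le> u m * u (m * k)"
    using Suc u_nonneg by (simp add: mult_left_mono)
  also have "\<dots> \<le> u (m + m * k)" by (rule u_supermult)
  finally show ?case by simp
qed

lemma f_le_u: assumes "n \<ge> 1" shows "f n \<le> u n"
proof -
  have "f n * u (n - n) \<le> (\<Sum>r = 1..n. f r * u (n - r))"
    using assms by (intro member_le_sum) (auto simp: f_nonneg u_nonneg)
  then show ?thesis using renewal[OF assms] by (simp add: u_0)
qed

lemma one_le_conv_radius: "1 \<le> conv_radius u"
proof (rule conv_radius_geI_ex')
  fix r :: real assume r: "0 < r" "ereal r < 1"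
  have "summable (\<lambda>n. r ^ n)" using r by (intro summable_geometric) (auto simp: one_ereal_def)
  then show "summable (\<lambda>n. u n * of_real r ^ n)"
    by (rule summable_comparison_test')
      (use r u_nonneg u_le_1 in \<open>auto simp: abs_mult intro!: mult_left_le_one_le\<close>)
qed

text \<open>
  By supermultiplicativity, the terms of index \<open>m * k\<close> of the series dominate the \<open>k\<close>-th power of
  the term of index \<open>m\<close>, so no term other than the constant one can reach \<open>1\<close> where the series
  converges. Both the finiteness of the radius and the bound \<open>u m * \<rho> ^ m \<le> 1\<close> rest on this.
\<close>

lemma term_less_1:
  assumes "m \<ge> 1" "0 \<le> z" "ereal z < conv_radius u"
  shows "u m * z ^ m < 1"
proof (rule ccontr)
  assume "\<not> u m * z ^ m < 1"
  then have ge: "1 \<le> u m * z ^ m" by simp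
  have "summable (\<lambda>n. u n * z ^ n)"
    using assms by (intro summable_in_conv_radius) auto
  then have "(\<lambda>n. u n * z ^ n) \<longlonglongrightarrow> 0" by (rule summable_LIMSEQ_zero)
  moreover have "filterlim (\<lambda>k. m * k) at_top sequentially"
    using assms(1) by (intro filterlim_subseq) (auto simp: strict_mono_def)
  ultimately have "(\<lambda>k. u (m * k) * z ^ (m * k)) \<longlonglongrightarrow> 0"
    by (rule filterlim_compose)
  then have "eventually (\<lambda>k. u (m * k) * z ^ (m * k) < 1) sequentially"
    by (rule order_tendstoD) simp
  then obtain k where k: "u (m * k) * z ^ (m * k) < 1"
    by (auto simp: eventually_sequentially)
  have "1 \<le> (u m * z ^ m) ^ k" using ge by (rule one_le_power)
  also have "\<dots> = u m ^ k * z ^ (m * k)" by (simp add: power_mult_distrib power_mult)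
  also have "\<dots> \<le> u (m * k) * z ^ (m * k)"
    using assms by (intro mult_right_mono u_power_le) auto
  finally show False using k by simp
qed

lemma conv_radius_finite: "conv_radius u < \<infinity>"
proof (rule ccontr)
  assume "\<not> conv_radius u < \<infinity>"
  then have *: "conv_radius u = \<infinity>" by simp
  have "u 2 * (1 / u 2) ^ 2 < 1"
    using u_2_pos by (intro term_less_1) (auto simp: *)
  then have "1 < u 2" using u_2_pos by (simp add: power2_eq_square)
  then show False using u_le_1[of 2] by simp
qed

lemma ereal_rho: "ereal \<rho> = conv_radius u"
  unfolding \<rho>_def using one_le_conv_radius conv_radius_finite by (intro ereal_real') auto

lemma rho_ge_1: "1 \<le> \<rho>"
  using one_le_conv_radius by (simp flip: ereal_rho)

text \<open>
  The series for \<open>u\<close> may diverge at \<open>\<rho>\<close> itself, so inequalities at \<open>\<rho>\<close> are obtained for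
  polynomials inside the disc of convergence and carried to the boundary by continuity.
\<close>

lemma tendsto_below_rho:
  assumes "continuous_on UNIV h" "\<And>z. 0 < z \<Longrightarrow> z < \<rho> \<Longrightarrow> h z \<le> (1::real)"
  shows "h \<rho> \<le> 1"
proof -
  have "(h \<longlongrightarrow> h \<rho>) (at_left \<rho>)"
    using assms(1) by (auto simp: continuous_on_def intro: tendsto_within_subset)
  moreover have "eventually (\<lambda>z. h z \<le> 1) (at_left \<rho>)"
    using rho_ge_1 eventually_at_left[of 0 \<rho>] by (auto intro!: assms(2) exI[of _ 0])
  ultimately show ?thesis by (rule tendsto_upperbound) simp
qed

lemma u_rho_le_1: "u m * \<rho> ^ m \<le> 1"
proof (cases "m = 0")
  case False
  show ?thesis
  proof (rule tendsto_below_rho[of "\<lambda>z. u m * z ^ m"])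
    fix z assume "0 < z" "z < \<rho>"
    then show "u m * z ^ m \<le> 1"
      using False by (intro order.strict_implies_order[OF term_less_1]) (auto simp flip: ereal_rho)
  qed (intro continuous_intros)
qed (simp add: u_0)

text \<open>
  Inside the disc of convergence the renewal equation reads \<open>F(z) U(z) = U(z) - 1\<close>, whence
  \<open>F(z) < 1\<close>. Partial sums of \<open>F\<close> are polynomials, so their bound extends to \<open>z = \<rho>\<close>.
\<close>

lemma F_partial_le_1: "(\<Sum>r = 1..L. f r * \<rho> ^ r) \<le> 1"
proof (rule tendsto_below_rho[of "\<lambda>z. \<Sum>r = 1..L. f r * z ^ r"])
  fix z assume z: "0 < z" "z < \<rho>"
  \<comment> \<open>The value \<open>a 0 = 0\<close> makes the Cauchy product the renewal convolution.\<close>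
  define a where "a n = (if n = 0 then 0 else f n * z ^ n)" for n
  define b where "b n = u n * z ^ n" for n
  have sb: "summable b"
    unfolding b_def using z by (intro summable_in_conv_radius) (auto simp flip: ereal_rho)
  have ab: "0 \<le> a n" "a n \<le> b n" for n
    using z f_le_u[of n] by (auto simp: a_def b_def f_nonneg u_nonneg mult_right_mono)
  have sa: "summable a"
    by (rule summable_comparison_test'[OF sb, of 0]) (use ab in auto)
  have "(\<Sum>k. a k) * (\<Sum>k. b k) = (\<Sum>k. \<Sum>i\<le>k. a i * b (k - i))"
    by (rule Cauchy_product)
      (use sa sb ab order.trans[OF ab] in \<open>auto simp: abs_of_nonneg\<close>)
  also have "(\<lambda>k. \<Sum>i\<le>k. a i * b (k - i)) = (\<lambda>k. b k - (if k = 0 then 1 else 0))"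
  proof
    fix k
    show "(\<Sum>i\<le>k. a i * b (k - i)) = b k - (if k = 0 then 1 else 0)"
    proof (cases "k = 0")
      case False
      have "(\<Sum>i\<le>k. a i * b (k - i)) = (\<Sum>i = 1..k. a i * b (k - i))"
        by (rule sum.mono_neutral_right) (auto simp: a_def)
      also have "\<dots> = (\<Sum>i = 1..k. (f i * u (k - i)) * z ^ k)"
        by (intro sum.cong) (auto simp: a_def b_def simp flip: power_add)
      also have "\<dots> = b k"
        using renewal[of k] False by (simp add: b_def flip: sum_distrib_right)
      finally show ?thesis using False by simp
    qed (simp add: a_def b_def u_0)
  qed
  also have "(\<Sum>k. b k - (if k = 0 then 1 else 0)) = (\<Sum>k. b k) - 1"
  proof -
    have "(\<lambda>k. if k = 0 then 1 else 0 :: real) sums 1"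
      using sums_single[of 0 "\<lambda>_. 1::real"] by simp
    then show ?thesis using sb by (intro sums_unique[symmetric] sums_diff summable_sums)
  qed
  finally have eq: "(\<Sum>k. a k) * (\<Sum>k. b k) = (\<Sum>k. b k) - 1" .
  have "b 0 \<le> (\<Sum>k. b k)"
    using sum_le_suminf[OF sb, of "{0}"] ab order.trans[OF ab] by simp
  then have pos: "(\<Sum>k. b k) \<ge> 1" by (simp add: b_def u_0)
  have "(\<Sum>k. a k) \<le> 1"
  proof (rule ccontr)
    assume "\<not> ?thesis"
    then have "1 * (\<Sum>k. b k) \<le> (\<Sum>k. a k) * (\<Sum>k. b k)"
      using pos by (intro mult_right_mono) auto
    then show False using eq by simp
  qed
  moreover have "(\<Sum>r = 1..L. f r * z ^ r) = sum a {1..L}"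
    by (intro sum.cong) (auto simp: a_def)
  moreover have "sum a {1..L} \<le> (\<Sum>k. a k)"
    by (rule sum_le_suminf[OF sa]) (use ab in auto)
  ultimately show "(\<Sum>r = 1..L. f r * z ^ r) \<le> 1" by linarith
qed (intro continuous_intros)

definition F_rho :: real where "F_rho = (\<Sum>n. f (Suc n) * \<rho> ^ Suc n)"

lemma F_partial_eq: "(\<Sum>n<L. f (Suc n) * \<rho> ^ Suc n) = (\<Sum>r = 1..L. f r * \<rho> ^ r)"
  by (rule sum.reindex_bij_witness[of _ "\<lambda>r. r - 1" Suc]) auto

lemma F_term_nonneg: "f r * \<rho> ^ r \<ge> 0"
  using f_nonneg rho_ge_1 by simp

lemma F_summable: "summable (\<lambda>n. f (Suc n) * \<rho> ^ Suc n)"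
  by (rule summableI_nonneg_bounded[of _ 1])
    (use F_term_nonneg F_partial_le_1 in \<open>auto simp only: F_partial_eq\<close>)

lemma F_rho_le_1: "F_rho \<le> 1"
  unfolding F_rho_def
  by (rule suminf_le_const[OF F_summable]) (simp only: F_partial_eq F_partial_le_1)

lemma F_partial_tendsto: "(\<lambda>L. \<Sum>r = 1..L. f r * \<rho> ^ r) \<longlonglongrightarrow> F_rho"
  using summable_LIMSEQ[OF F_summable] unfolding F_partial_eq F_rho_def .

lemma F_partial_le_F: "(\<Sum>r = 1..L. f r * \<rho> ^ r) \<le> F_rho"
  unfolding F_partial_eq[symmetric] F_rho_def
  by (rule sum_le_suminf[OF F_summable]) (auto simp only: F_term_nonneg finite_lessThan)

lemma F_block_le:
  "(\<Sum>r \<in> {L<..<m}. f r * \<rho> ^ r) \<le> F_rho - (\<Sum>r = 1..L. f r * \<rho> ^ r)"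
proof -
  have "(\<Sum>r = 1..L. f r * \<rho> ^ r) + (\<Sum>r \<in> {L<..<m}. f r * \<rho> ^ r)
      = (\<Sum>r \<in> {1..L} \<union> {L<..<m}. f r * \<rho> ^ r)"
    by (rule sum.union_disjoint[symmetric]) auto
  also have "\<dots> \<le> (\<Sum>r = 1..max L m. f r * \<rho> ^ r)"
    by (rule sum_mono2) (auto simp: F_term_nonneg)
  finally show ?thesis using F_partial_le_F[of "max L m"] by linarith
qed

lemma period_dvd: "n \<ge> 1 \<Longrightarrow> u n > 0 \<Longrightarrow> period dvd n"
  unfolding period_def by (rule Gcd_dvd) auto

lemma period_dvd_f: "n \<ge> 1 \<Longrightarrow> \<not> period dvd n \<Longrightarrow> f n = 0"
  using period_dvd[of n] f_le_u[of n] f_nonneg[of n] u_nonneg[of n] by fastforce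

lemma period_pos: "period \<ge> 1"
  using period_dvd[of 2] u_2_pos by (cases period) auto

lemma u_even_pos: "u (2 * k) > 0"
  using u_power_le[of 2 k] u_2_pos by (auto intro: less_le_trans[OF zero_less_power])

text \<open>
  Even times are always possible return times. If some odd time is one too, all later times are;
  if none is, the period is even and its multiples are even times.
\<close>

lemma eventually_u_pos: "eventually (\<lambda>n. u (period * n) > 0) sequentially"
proof (cases "\<exists>n. odd n \<and> u n > 0")
  case True
  then obtain m where m: "odd m" "u m > 0" by blast
  have "u k > 0" if "k \<ge> m" for k
  proof (cases "even k")
    case True
    then show ?thesis using u_even_pos by (auto elim!: evenE)
  next
    case False
    then have "even (k - m)" using m that by simp
    then obtain j where "k - m = 2 * j" by (rule dvdE)
    then have "k = m + 2 * j" using that by simp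
    then show ?thesis
      using less_le_trans[OF mult_pos_pos[OF m(2) u_even_pos] u_supermult] by simp
  qed
  moreover have "period * n \<ge> m" if "n \<ge> m" for n
    using that period_pos by (metis mult_le_mono mult_1)
  ultimately show ?thesis unfolding eventually_sequentially by blast
next
  case False
  then have "even n" if "u n > 0" for n using that by blast
  then have "2 dvd period" unfolding period_def by (intro Gcd_greatest) auto
  then show ?thesis using u_even_pos by (auto elim!: dvdE simp: mult.assoc)
qed

text \<open>
  Otherwise \<open>u\<close> would be dominated by the geometric sequence \<open>c ^ n\<close> and its radius of
  convergence would be at least \<open>1 / c\<close>, which exceeds \<open>\<rho>\<close>.
\<close>

lemma exists_large_root:
  assumes "0 < c" "c < 1 / \<rho>"
  shows "\<exists>m\<ge>1. u m \<ge> c ^ m"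
proof (rule ccontr)
  assume "\<not> ?thesis"
  then have le: "m \<ge> 1 \<Longrightarrow> u m \<le> c ^ m" for m using not_le by (auto intro: less_imp_le)
  have "ereal (1 / c) \<le> conv_radius u"
  proof (rule conv_radius_geI_ex')
    fix r :: real assume r: "0 < r" "ereal r < ereal (1 / c)"
    then have "r * c < 1" using assms by (simp add: field_simps)
    then have "summable (\<lambda>n. (r * c) ^ n)" using r assms by (intro summable_geometric) auto
    then show "summable (\<lambda>n. u n * of_real r ^ n)"
      by (rule summable_comparison_test'[of _ 1])
        (use r le u_nonneg in \<open>auto simp: power_mult_distrib mult.commute[of "r ^ _"] intro!: mult_right_mono\<close>)
  qed
  then have "1 / c \<le> \<rho>" by (simp flip: ereal_rho)
  then show False using assms rho_ge_1 by (simp add: field_simps)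
qed

text \<open>
  This is the half of Fekete's argument that needs work: one index \<open>m0\<close> with a large root controls
  every large multiple of the period, by writing it as many copies of \<open>m0\<close> plus one of finitely
  many remainders. The shift by \<open>N\<close> keeps the remainders where \<open>u\<close> is positive.
\<close>

lemma eventually_u_ge_geometric:
  assumes "0 < c" "c < 1 / \<rho>"
  shows "\<exists>\<delta>>0. eventually (\<lambda>n. u (period * n) \<ge> \<delta> * c ^ (period * n)) sequentially"
proof -
  obtain m0 where m0: "m0 \<ge> 1" "u m0 \<ge> c ^ m0" using exists_large_root[OF assms] by blast
  have "u m0 > 0" using m0 assms(1) by (auto intro: less_le_trans[OF zero_less_power])
  then have "period dvd m0" using m0 period_dvd by blast
  then obtain m where m: "m0 = period * m" by blast
  have "m \<ge> 1" using m m0 by (cases m) auto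
  obtain N where N: "\<And>n. n \<ge> N \<Longrightarrow> u (period * n) > 0"
    using eventually_u_pos by (auto simp: eventually_sequentially)
  define \<delta> where "\<delta> = Min ((\<lambda>r. u (period * (N + r))) ` {..<m})"
  have \<delta>: "\<delta> > 0" "r < m \<Longrightarrow> \<delta> \<le> u (period * (N + r))" for r
    unfolding \<delta>_def using \<open>m \<ge> 1\<close> N by (auto simp: Min_gr_iff lessThan_empty_iff)
  have "c < 1"
    using assms rho_ge_1 by (auto intro: less_le_trans)
  have "u (period * n) \<ge> \<delta> * c ^ (period * n)" if "n \<ge> N" for n
  proof -
    define q where "q = (n - N) div m"
    define r where "r = (n - N) mod m"
    have n: "n = m * q + (N + r)" "r < m"
      using that \<open>m \<ge> 1\<close> by (auto simp: q_def r_def)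
    have "\<delta> * c ^ (period * n) \<le> u (period * (N + r)) * c ^ (period * (m * q))"
      using assms \<open>c < 1\<close> \<delta> n u_nonneg by (intro mult_mono power_decreasing) auto
    also have "c ^ (period * (m * q)) = (c ^ m0) ^ q" by (simp add: m mult.assoc flip: power_mult)
    also have "u (period * (N + r)) * (c ^ m0) ^ q \<le> u (period * (N + r)) * u (m0 * q)"
      using m0 assms u_nonneg by (intro mult_left_mono order.trans[OF power_mono u_power_le]) auto
    also have "\<dots> \<le> u (period * (N + r) + m0 * q)" by (rule u_supermult)
    also have "period * (N + r) + m0 * q = period * n" by (simp add: n m algebra_simps)
    finally show ?thesis .
  qed
  then show ?thesis using \<delta>(1) by (auto simp: eventually_sequentially)
qed

lemma period_times_at_top: "filterlim (\<lambda>n. real (period * n)) at_top sequentially"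
  using period_pos
  by (intro filterlim_compose[OF filterlim_real_sequentially] filterlim_subseq) (auto simp: strict_mono_def)

theorem u_root_tendsto:
  "(\<lambda>n. u (period * n) powr (1 / real (period * n))) \<longlonglongrightarrow> 1 / \<rho>"
proof (rule order_tendstoI)
  fix a assume a: "a < 1 / \<rho>"
  then have "max a 0 < 1 / \<rho>" using rho_ge_1 by simp
  then obtain c where "max a 0 < c" "c < 1 / \<rho>" using dense by blast
  then have c: "0 < c" "c < 1 / \<rho>" "a < c" by simp_all
  obtain \<delta> where \<delta>: "\<delta> > 0"
    "eventually (\<lambda>n. u (period * n) \<ge> \<delta> * c ^ (period * n)) sequentially"
    using eventually_u_ge_geometric[OF c(1,2)] by blast
  have "((\<lambda>n. \<delta> powr (1 / real (period * n)) * c) \<longlongrightarrow> \<delta> powr 0 * c) sequentially"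
    using \<delta>(1) by (intro tendsto_intros real_tendsto_divide_at_top[OF tendsto_const period_times_at_top]) auto
  then have "eventually (\<lambda>n. \<delta> powr (1 / real (period * n)) * c > a) sequentially"
    using c(3) \<delta>(1) by (intro order_tendstoD(1)) auto
  with \<delta>(2) eventually_gt_at_top[of 0]
  show "eventually (\<lambda>n. a < u (period * n) powr (1 / real (period * n))) sequentially"
  proof eventually_elim
    case (elim n)
    let ?n = "period * n"
    have pos: "?n > 0" using elim period_pos by auto
    have "a < \<delta> powr (1 / real ?n) * c" by fact
    also have "\<dots> = (\<delta> * c ^ ?n) powr (1 / real ?n)"
      using \<delta>(1) c(1) pos
      by (simp add: powr_mult powr_powr flip: powr_realpow del: of_nat_mult)
    also have "\<dots> \<le> u ?n powr (1 / real ?n)"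
      using elim \<delta>(1) c(1) by (intro powr_mono2) auto
    finally show ?case .
  qed
next
  fix a assume a: "1 / \<rho> < a"
  show "eventually (\<lambda>n. u (period * n) powr (1 / real (period * n)) < a) sequentially"
    using eventually_gt_at_top[of 0]
  proof eventually_elim
    case (elim n)
    let ?n = "period * n"
    have pos: "?n > 0" using elim period_pos by auto
    have "u ?n \<le> (1 / \<rho>) ^ ?n"
      using u_rho_le_1[of ?n] rho_ge_1 by (simp add: field_simps)
    then have "u ?n powr (1 / real ?n) \<le> ((1 / \<rho>) ^ ?n) powr (1 / real ?n)"
      by (intro powr_mono2) (auto simp: u_nonneg)
    also have "\<dots> = 1 / \<rho>"
      using pos rho_ge_1 by (simp add: powr_powr flip: powr_realpow del: of_nat_mult power_one_over)
    finally show ?case using a by simp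
  qed
qed

end

section \<open>Finite trajectories of a Markov kernel\<close>

text \<open>
  The law of the list of the first \<open>n + 1\<close> positions of the chain with kernel \<open>K\<close> started at \<open>x\<close>.
  Growing the list at its end matches the way in which a Markov chain is specified. The starting
  point is kept in the list, so that a loop can be recognised from the list alone.
\<close>

primrec traj :: "('v \<Rightarrow> 'v pmf) \<Rightarrow> 'v \<Rightarrow> nat \<Rightarrow> 'v list pmf" where
  "traj K x 0 = return_pmf [x]"
| "traj K x (Suc n) = bind_pmf (traj K x n) (\<lambda>l. map_pmf (\<lambda>y. l @ [y]) (K (last l)))"

lemma length_hd_traj: "l \<in> set_pmf (traj K x n) \<Longrightarrow> length l = Suc n \<and> hd l = x"
proof (induction n arbitrary: l)
  case (Suc n)
  then obtain l' y where "l' \<in> set_pmf (traj K x n)" "l = l' @ [y]" by auto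
  with Suc.IH[of l'] show ?case by (auto simp: hd_append)
qed simp

text \<open>
  The Markov property at time \<open>m\<close>. The second piece starts where the first one ends; \<open>tl\<close> drops this
  common vertex.
\<close>

lemma traj_add:
  "traj K x (m + n) = bind_pmf (traj K x m) (\<lambda>a. map_pmf (\<lambda>b. a @ tl b) (traj K (last a) n))"
proof (induction n)
  case 0
  then show ?case by (simp add: bind_return_pmf')
next
  case (Suc n)
  have "traj K x (m + Suc n) = bind_pmf (traj K x m) (\<lambda>a. bind_pmf (traj K (last a) n)
      (\<lambda>b. map_pmf (\<lambda>y. (a @ tl b) @ [y]) (K (last (a @ tl b)))))"
    by (simp add: Suc bind_assoc_pmf bind_map_pmf)
  also have "\<dots> = bind_pmf (traj K x m) (\<lambda>a. bind_pmf (traj K (last a) n)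
      (\<lambda>b. map_pmf (\<lambda>y. a @ tl (b @ [y])) (K (last b))))"
  proof (intro bind_pmf_cong refl)
    fix a b assume a: "a \<in> set_pmf (traj K x m)" and b: "b \<in> set_pmf (traj K (last a) n)"
    from length_hd_traj[OF a] length_hd_traj[OF b]
    have "last (a @ tl b) = last b" "b \<noteq> []"
      by (cases b; auto)+
    then show "map_pmf (\<lambda>y. (a @ tl b) @ [y]) (K (last (a @ tl b)))
        = map_pmf (\<lambda>y. a @ tl (b @ [y])) (K (last b))"
      by (simp add: tl_append2)
  qed
  also have "\<dots> = bind_pmf (traj K x m) (\<lambda>a. map_pmf (\<lambda>b. a @ tl b) (traj K (last a) (Suc n)))"
    by (simp add: map_bind_pmf pmf.map_comp o_def)
  finally show ?case .
qed

lemma pmf_bind_snoc: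
  "pmf (bind_pmf p (\<lambda>l. map_pmf (\<lambda>y. l @ [y]) (k l))) (l @ [y]) = pmf p l * pmf (k l) y"
proof -
  have "pmf (map_pmf (\<lambda>y. l' @ [y]) (k l')) (l @ [y]) = indicator {l} l' * pmf (k l) y" for l'
  proof (cases "l' = l")
    case True
    then show ?thesis using pmf_map_inj'[of "\<lambda>y. l @ [y]" "k l" y] by (simp add: inj_def)
  next
    case False
    then have "l @ [y] \<notin> set_pmf (map_pmf (\<lambda>y. l' @ [y]) (k l'))" by auto
    then show ?thesis using False by (simp add: pmf_eq_0_set_pmf)
  qed
  then show ?thesis by (simp add: pmf_bind measure_pmf_single)
qed

lemma last_in_lists: "l \<in> lists V \<Longrightarrow> l \<noteq> [] \<Longrightarrow> last l \<in> V"
  using last_in_set[of l] by (auto simp: in_lists_conv_set simp del: last_in_set)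

lemma traj_closed:
  assumes "\<And>x. x \<in> V \<Longrightarrow> set_pmf (K x) \<subseteq> V" "x \<in> V"
  shows "set_pmf (traj K x n) \<subseteq> lists V"
proof (induction n)
  case (Suc n)
  show ?case
  proof
    fix l assume "l \<in> set_pmf (traj K x (Suc n))"
    then obtain l' y where l: "l' \<in> set_pmf (traj K x n)" "y \<in> set_pmf (K (last l'))" "l = l' @ [y]"
      by auto
    then have "last l' \<in> V"
      using Suc length_hd_traj[OF l(1)] by (intro last_in_lists) auto
    then show "l \<in> lists V" using assms(1) l Suc by auto
  qed
qed (simp add: assms)

lemma traj_equivariant:
  assumes "\<And>x. x \<in> V \<Longrightarrow> set_pmf (K x) \<subseteq> V" "x \<in> V"
    and "\<And>x. x \<in> V \<Longrightarrow> K (\<phi> x) = map_pmf \<phi> (K x)"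
  shows "traj K (\<phi> x) n = map_pmf (map \<phi>) (traj K x n)"
proof (induction n)
  case (Suc n)
  have "traj K (\<phi> x) (Suc n) = bind_pmf (traj K x n)
      (\<lambda>l. map_pmf (\<lambda>y. map \<phi> l @ [y]) (K (last (map \<phi> l))))"
    by (simp add: Suc bind_map_pmf)
  also have "\<dots> = bind_pmf (traj K x n) (\<lambda>l. map_pmf (\<lambda>y. map \<phi> (l @ [y])) (K (last l)))"
  proof (intro bind_pmf_cong refl)
    fix l assume l: "l \<in> set_pmf (traj K x n)"
    then have "l \<noteq> []" using length_hd_traj[OF l] by auto
    moreover have "last l \<in> V"
      using traj_closed[where K = K and n = n, OF assms(1,2)] l \<open>l \<noteq> []\<close>
      by (intro last_in_lists) auto
    ultimately show "map_pmf (\<lambda>y. map \<phi> l @ [y]) (K (last (map \<phi> l)))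
        = map_pmf (\<lambda>y. map \<phi> (l @ [y])) (K (last l))"
      by (simp add: last_map assms(3) pmf.map_comp o_def)
  qed
  also have "\<dots> = map_pmf (map \<phi>) (traj K x (Suc n))"
    by (simp add: map_bind_pmf pmf.map_comp o_def)
  finally show ?case .
qed simp

text \<open>
  The mechanism behind all path computations. Suppose that the path between the times \<open>k\<close> and
  \<open>k + r\<close> is a loop of some shape \<open>B\<close> whose probability \<open>c\<close> is the same from every base point.
  After such a loop the walk is back where it was at time \<open>k\<close>, so by the Markov property it goes on
  as if the loop had not happened: cutting the loop out leaves a path with the law of a shorter
  walk, and the loop contributes the factor \<open>c\<close>.
\<close>

lemma traj_loop_excision:
  assumes K: "\<And>x. x \<in> V \<Longrightarrow> set_pmf (K x) \<subseteq> V" and x: "x \<in> V"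
    and c: "\<And>y. y \<in> V \<Longrightarrow> measure_pmf.prob (traj K y r) {b. B b} = c"
    and loop: "\<And>b. length b = Suc r \<Longrightarrow> B b \<Longrightarrow> last b = hd b"
  shows "measure_pmf.prob (traj K x (k + r + m))
      {l. B (take (Suc r) (drop k l)) \<and> A (take (Suc k) l @ drop (Suc (k + r)) l)}
    = c * measure_pmf.prob (traj K x (k + m)) {l. A l}"
proof -
  let ?E = "{l. B (take (Suc r) (drop k l)) \<and> A (take (Suc k) l @ drop (Suc (k + r)) l)}"
  define g where "g a = emeasure (traj K (last a) m) {z. A (a @ tl z)}" for a
  have c0: "0 \<le> c" using c[OF x] measure_nonneg by metis
  have "emeasure (traj K x (k + r + m)) ?E =
    (\<integral>\<^sup>+a. \<integral>\<^sup>+b. emeasure (traj K (last (a @ tl b)) m) {z. (a @ tl b) @ tl z \<in> ?E}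
       \<partial>traj K (last a) r \<partial>traj K x k)"
    by (simp add: traj_add[of K x "k + r"] traj_add[of K x k] vimage_def
      del: take_append drop_append)
  also have "\<dots> = (\<integral>\<^sup>+a. \<integral>\<^sup>+b. indicator {b. B b} b * g a \<partial>traj K (last a) r \<partial>traj K x k)"
  proof (intro nn_integral_cong_AE AE_pmfI)
    fix a b assume a: "a \<in> set_pmf (traj K x k)" and b: "b \<in> set_pmf (traj K (last a) r)"
    obtain a' y where a': "a = a' @ [y]" "length a' = k"
      using length_hd_traj[OF a] by (cases a rule: rev_cases) auto
    obtain b' where b': "b = y # b'" "length b' = r"
      using length_hd_traj[OF b] a' by (cases b) auto
    have eq: "(a @ tl b) @ tl z \<in> ?E \<longleftrightarrow> B b \<and> A (a @ tl z)" for z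
      by (simp add: a' b')
    show "emeasure (traj K (last (a @ tl b)) m) {z. (a @ tl b) @ tl z \<in> ?E}
        = indicator {b. B b} b * g a"
    proof (cases "B b")
      case True
      then have "last (a @ tl b) = last a"
        using loop[of b] by (auto simp: a' b' split: if_splits)
      with True show ?thesis unfolding eq by (simp add: g_def)
    next
      case False
      then show ?thesis unfolding eq by simp
    qed
  qed
  also have "\<dots> = (\<integral>\<^sup>+a. ennreal c * g a \<partial>traj K x k)"
  proof (intro nn_integral_cong_AE AE_pmfI)
    fix a assume a: "a \<in> set_pmf (traj K x k)"
    then have "last a \<in> V"
      using traj_closed[where K = K and n = k, OF K x] length_hd_traj[OF a]
      by (intro last_in_lists) auto
    then show "(\<integral>\<^sup>+b. indicator {b. B b} b * g a \<partial>traj K (last a) r) = ennreal c * g a"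
      using c[of "last a"] by (simp add: nn_integral_multc measure_pmf.emeasure_eq_measure)
  qed
  also have "\<dots> = ennreal c * (\<integral>\<^sup>+a. g a \<partial>traj K x k)"
    by (simp add: nn_integral_cmult)
  also have "(\<integral>\<^sup>+a. g a \<partial>traj K x k) = emeasure (traj K x (k + m)) {l. A l}"
    by (simp add: traj_add[of K x k] g_def vimage_def)
  finally show ?thesis
    using c0 by (simp add: measure_pmf.emeasure_eq_measure ennreal_mult'[symmetric])
qed

section \<open>Walks with a symmetric transitive kernel\<close>

text \<open>
  The common form of the two kinds of walk: a Markov chain with a symmetric kernel whose
  automorphisms act transitively. Only maps that carry the base point \<open>e\<close> to a given vertex are
  demanded, since all statements compare walks from another vertex with walks from \<open>e\<close>. The Markov
  property is stated for whole histories, which determines the law of every finite path.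
\<close>

locale transitive_walk = prob_space M for M :: "'w measure" +
  fixes V :: "'v set" and K :: "'v \<Rightarrow> 'v pmf" and e :: 'v and S :: "nat \<Rightarrow> 'w \<Rightarrow> 'v"
  assumes countable_V: "countable V"
    and e_in_V: "e \<in> V"
    and K_closed: "x \<in> V \<Longrightarrow> set_pmf (K x) \<subseteq> V"
    and K_sym: "x \<in> V \<Longrightarrow> y \<in> V \<Longrightarrow> pmf (K x) y = pmf (K y) x"
    and K_transitive: "v \<in> V \<Longrightarrow>
      \<exists>\<phi>. inj_on \<phi> V \<and> \<phi> e = v \<and> (\<forall>x\<in>V. K (\<phi> x) = map_pmf \<phi> (K x))"
    and S_measurable: "S n \<in> measurable M (count_space V)"
    and S_start: "AE \<omega> in M. S 0 \<omega> = e"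
    and S_step: "(\<And>k. k \<le> Suc n \<Longrightarrow> h k \<in> V) \<Longrightarrow>
      \<P>(\<omega> in M. \<forall>k\<le>Suc n. S k \<omega> = h k) =
      \<P>(\<omega> in M. \<forall>k\<le>n. S k \<omega> = h k) * pmf (K (h n)) (h (Suc n))"
begin

lemma S_measurable_UNIV [measurable]: "S n \<in> measurable M (count_space UNIV)"
  using measurable_compose[OF S_measurable, of id "count_space UNIV"] by simp

lemma S_in_V: "\<omega> \<in> space M \<Longrightarrow> S n \<omega> \<in> V"
  using measurable_space[OF S_measurable] by simp

abbreviation path :: "nat \<Rightarrow> 'w \<Rightarrow> 'v list" where
  "path n \<omega> \<equiv> map (\<lambda>k. S k \<omega>) [0..<Suc n]"

lemma path_eq_iff: "path n \<omega> = l \<longleftrightarrow> length l = Suc n \<and> (\<forall>k\<le>n. S k \<omega> = l ! k)"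
  by (auto simp: list_eq_iff_nth_eq less_Suc_eq_le simp del: upt_Suc)

lemma path_measurable: "path n \<in> measurable M (count_space UNIV)"
proof -
  have "path n \<in> measurable M (count_space (lists V))"
  proof (subst measurable_count_space_eq_countable)
    show "countable (lists V)" using countable_V by (rule countable_lists)
    show "path n \<in> space M \<rightarrow> lists V \<and> (\<forall>l\<in>lists V. path n -` {l} \<inter> space M \<in> events)"
    proof (intro conjI ballI)
      show "path n \<in> space M \<rightarrow> lists V" using S_in_V by (auto simp: in_lists_conv_set)
      fix l
      have "path n -` {l} \<inter> space M = {\<omega> \<in> space M. length l = Suc n \<and> (\<forall>k\<le>n. S k \<omega> = l ! k)}"
        using path_eq_iff[where n = n and l = l] by blast
      also have "\<dots> \<in> events" by measurable
      finally show "path n -` {l} \<inter> space M \<in> events" .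
    qed
  qed
  from measurable_compose[OF this, of id "count_space UNIV"] show ?thesis by (simp add: o_def)
qed

lemma path_pred: "Measurable.pred M (\<lambda>\<omega>. \<Phi> (path n \<omega>))"
  by (rule measurable_compose[OF path_measurable]) simp

lemma pred_S_eq_S [measurable]: "Measurable.pred M (\<lambda>\<omega>. S i \<omega> = S j \<omega>)"
  using path_pred[of "\<lambda>l. l ! i = l ! j" "max i j"]
  by (simp add: less_Suc_eq_le nth_upt del: upt_Suc)

lemma prob_path_eq:
  "(\<And>k. k \<le> n \<Longrightarrow> x k \<in> V) \<Longrightarrow>
    \<P>(\<omega> in M. \<forall>k\<le>n. S k \<omega> = x k) = pmf (traj K e n) (map x [0..<Suc n])"
proof (induction n)
  case 0
  have "\<P>(\<omega> in M. S 0 \<omega> = x 0) = \<P>(\<omega> in M. e = x 0)"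
    using S_start by (intro prob_eq_AE) auto
  then show ?case by (cases "e = x 0") (auto simp: prob_space)
next
  case (Suc n)
  have "map x [0..<Suc (Suc n)] = map x [0..<Suc n] @ [x (Suc n)]" by simp
  then show ?case
    using Suc by (simp add: S_step pmf_bind_snoc del: upt_Suc) simp
qed

text \<open>
  Finite paths form a countable set, so the two laws agree as soon as they agree on single paths.
  From here on, probabilities of events that depend on finitely many positions can be computed
  with \<open>traj\<close>.
\<close>

lemma prob_path:
  "\<P>(\<omega> in M. \<Phi> (path n \<omega>)) = measure_pmf.prob (traj K e n) {l. \<Phi> l}"
proof -
  let ?\<Omega> = "{l \<in> lists V. length l = Suc n}"
  have "distr M (count_space UNIV) (path n) = measure_pmf (traj K e n)"
  proof (rule measure_eqI_countable_AE[of _ _ ?\<Omega>])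
    show "AE l in distr M (count_space UNIV) (path n). l \<in> ?\<Omega>"
      using S_in_V by (subst AE_distr_iff[OF path_measurable]) (auto simp: in_lists_conv_set)
    show "AE l in traj K e n. l \<in> ?\<Omega>"
      using traj_closed[where K = K and n = n, OF K_closed e_in_V] length_hd_traj by (fastforce intro: AE_pmfI)
    show "countable ?\<Omega>" using countable_lists[OF countable_V] by (rule countable_subset[rotated]) auto
    fix l assume l: "l \<in> ?\<Omega>"
    have "path n -` {l} \<inter> space M = {\<omega> \<in> space M. \<forall>k\<le>n. S k \<omega> = l ! k}"
      using path_eq_iff[where n = n and l = l] l by blast
    moreover have "\<P>(\<omega> in M. \<forall>k\<le>n. S k \<omega> = l ! k) = pmf (traj K e n) (map ((!) l) [0..<Suc n])"
      using l by (intro prob_path_eq) (auto simp: in_lists_conv_set)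
    moreover have "map ((!) l) [0..<Suc n] = l" using l map_nth[of l] by simp
    ultimately show "emeasure (distr M (count_space UNIV) (path n)) {l} = emeasure (traj K e n) {l}"
      by (simp add: emeasure_distr[OF path_measurable] emeasure_pmf_single emeasure_eq_measure del: upt_Suc)
  qed simp_all
  then have "measure_pmf.prob (traj K e n) {l. \<Phi> l}
      = measure (distr M (count_space UNIV) (path n)) {l. \<Phi> l}"
    by simp
  also have "\<dots> = prob (path n -` {l. \<Phi> l} \<inter> space M)"
    by (rule measure_distr[OF path_measurable]) simp
  also have "path n -` {l. \<Phi> l} \<inter> space M = {\<omega> \<in> space M. \<Phi> (path n \<omega>)}" by blast
  finally show ?thesis by simp
qed

text \<open>
  Loop excision for the walk itself. Transitivity enters here: the shape \<open>B\<close> is preserved by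
  injective relabellings of the vertices, so a loop of that shape is as likely at the current
  position of the walk as it is at \<open>e\<close>.
\<close>

lemma loop_excision:
  assumes inv: "\<And>\<phi> b. inj_on \<phi> V \<Longrightarrow> length b = Suc r \<Longrightarrow> set b \<subseteq> V \<Longrightarrow> B (map \<phi> b) \<longleftrightarrow> B b"
    and loop: "\<And>b. length b = Suc r \<Longrightarrow> B b \<Longrightarrow> last b = hd b"
  shows "\<P>(\<omega> in M. B (map (\<lambda>i. S i \<omega>) [k..<Suc (k + r)]) \<and>
      A (map (\<lambda>i. S i \<omega>) ([0..<Suc k] @ [Suc (k + r)..<Suc (k + r + m)])))
    = \<P>(\<omega> in M. B (path r \<omega>)) * \<P>(\<omega> in M. A (path (k + m) \<omega>))"
proof -
  have c: "measure_pmf.prob (traj K y r) {b. B b} = \<P>(\<omega> in M. B (path r \<omega>))" if y: "y \<in> V" for y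
  proof -
    obtain \<phi> where \<phi>: "inj_on \<phi> V" "\<phi> e = y" "\<And>x. x \<in> V \<Longrightarrow> K (\<phi> x) = map_pmf \<phi> (K x)"
      using K_transitive[OF y] by blast
    have "traj K y r = map_pmf (map \<phi>) (traj K e r)"
      using traj_equivariant[where K = K, OF K_closed e_in_V \<phi>(3)] \<phi>(2) by blast
    then have "measure_pmf.prob (traj K y r) {b. B b} = measure_pmf.prob (traj K e r) {b. B (map \<phi> b)}"
      by (simp add: vimage_def)
    also have "\<dots> = measure_pmf.prob (traj K e r) {b. B b}"
    proof (intro measure_pmf.finite_measure_eq_AE AE_pmfI)
      fix b assume b: "b \<in> set_pmf (traj K e r)"
      then have "set b \<subseteq> V"
        using traj_closed[where K = K and n = r, OF K_closed e_in_V] by auto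
      then show "b \<in> {b. B (map \<phi> b)} \<longleftrightarrow> b \<in> {b. B b}"
        using inv[OF \<phi>(1)] length_hd_traj[OF b] by simp
    qed simp_all
    also have "\<dots> = \<P>(\<omega> in M. B (path r \<omega>))" by (rule prob_path[symmetric])
    finally show ?thesis .
  qed
  have "take (Suc r) (drop k (path (k + r + m) \<omega>)) = map (\<lambda>i. S i \<omega>) [k..<Suc (k + r)]"
    "take (Suc k) (path (k + r + m) \<omega>) @ drop (Suc (k + r)) (path (k + r + m) \<omega>)
      = map (\<lambda>i. S i \<omega>) ([0..<Suc k] @ [Suc (k + r)..<Suc (k + r + m)])" for \<omega>
    by (simp_all add: take_map drop_map del: upt_Suc)
  then have "\<P>(\<omega> in M. B (map (\<lambda>i. S i \<omega>) [k..<Suc (k + r)]) \<and>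
      A (map (\<lambda>i. S i \<omega>) ([0..<Suc k] @ [Suc (k + r)..<Suc (k + r + m)])))
    = \<P>(\<omega> in M. B (take (Suc r) (drop k (path (k + r + m) \<omega>))) \<and>
      A (take (Suc k) (path (k + r + m) \<omega>) @ drop (Suc (k + r)) (path (k + r + m) \<omega>)))"
    by (simp only:)
  also have "\<dots> = \<P>(\<omega> in M. B (path r \<omega>)) * \<P>(\<omega> in M. A (path (k + m) \<omega>))"
    unfolding prob_path[of _ "k + m"]
    by (subst prob_path[of "\<lambda>l. B (take (Suc r) (drop k l)) \<and> A (take (Suc k) l @ drop (Suc (k + r)) l)"])
      (rule traj_loop_excision[OF K_closed e_in_V c loop])
  finally show ?thesis .
qed

subsection \<open>Probabilities of first return loops\<close>

abbreviation u :: "nat \<Rightarrow> real" where "u \<equiv> return_prob M S e"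
abbreviation f :: "nat \<Rightarrow> real" where "f \<equiv> first_return_prob M S e"

definition first_loop :: "nat \<Rightarrow> nat \<Rightarrow> 'w \<Rightarrow> bool" where
  "first_loop k r \<omega> \<longleftrightarrow> S (k + r) \<omega> = S k \<omega> \<and> (\<forall>j\<in>{1..<r}. S (k + j) \<omega> \<noteq> S k \<omega>)"

lemma first_loop_measurable [measurable]: "Measurable.pred M (first_loop k r)"
  unfolding first_loop_def by measurable

lemma nth_path_segment: "j < n - m \<Longrightarrow> map (\<lambda>i. S i \<omega>) [m..<n] ! j = S (m + j) \<omega>"
  by (simp add: nth_upt)

text \<open>
  A first return is a loop whose shape involves only equalities and inequalities between vertices,
  hence it may be excised.
\<close>

lemma first_loop_excision:
  assumes "r \<ge> 1"
  shows "\<P>(\<omega> in M. first_loop k r \<omega> \<and>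
      A (map (\<lambda>i. S i \<omega>) ([0..<Suc k] @ [Suc (k + r)..<Suc (k + r + m)])))
    = f r * \<P>(\<omega> in M. A (path (k + m) \<omega>))"
proof -
  define B where "B b \<longleftrightarrow> b ! r = b ! 0 \<and> (\<forall>j\<in>{1..<r}. b ! j \<noteq> b ! 0)" for b :: "'v list"
  have B: "B (map (\<lambda>i. S i \<omega>) [m..<Suc (m + r)]) \<longleftrightarrow> first_loop m r \<omega>" for m \<omega>
    by (auto simp: B_def first_loop_def nth_path_segment simp del: upt_Suc)
  have "\<P>(\<omega> in M. first_loop k r \<omega> \<and>
      A (map (\<lambda>i. S i \<omega>) ([0..<Suc k] @ [Suc (k + r)..<Suc (k + r + m)])))
    = \<P>(\<omega> in M. first_loop 0 r \<omega>) * \<P>(\<omega> in M. A (path (k + m) \<omega>))"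
    unfolding B[symmetric]
  proof (subst loop_excision)
    fix \<phi> :: "'v \<Rightarrow> 'v" and b :: "'v list"
    assume \<phi>: "inj_on \<phi> V" and b: "length b = Suc r" "set b \<subseteq> V"
    have "\<phi> (b ! i) = \<phi> (b ! j) \<longleftrightarrow> b ! i = b ! j" if "i \<le> r" "j \<le> r" for i j
      using inj_on_eq_iff[OF \<phi>] b that by (auto simp: subset_iff)
    then show "B (map \<phi> b) \<longleftrightarrow> B b" using b by (auto simp: B_def)
  next
    fix b :: "'v list" assume "length b = Suc r" "B b"
    then show "last b = hd b" by (cases b) (auto simp: B_def last_conv_nth)
  qed simp
  also have "\<P>(\<omega> in M. first_loop 0 r \<omega>) = f r"
    unfolding first_return_prob_def
  proof (intro prob_eq_AE)
    show "AE \<omega> in M. first_loop 0 r \<omega> \<longleftrightarrow> (\<forall>k\<in>{1..r - 1}. S k \<omega> \<noteq> e) \<and> S r \<omega> = e"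
      using S_start
    proof eventually_elim
      case (elim \<omega>)
      have "{1..<r} = {1..r - 1}" using assms by auto
      with elim show ?case by (auto simp: first_loop_def)
    qed
  qed measurable
  finally show ?thesis .
qed

lemma prob_first_loop:
  assumes "r \<ge> 1" "k + r \<le> n"
  shows "\<P>(\<omega> in M. first_loop k r \<omega> \<and> S n \<omega> = e) = f r * u (n - r)"
proof -
  obtain m where m: "n = k + r + m" using assms(2) by (auto simp: le_iff_add)
  have "first_loop k r \<omega> \<and> S n \<omega> = e \<longleftrightarrow> first_loop k r \<omega> \<and>
      map (\<lambda>i. S i \<omega>) ([0..<Suc k] @ [Suc (k + r)..<Suc (k + r + m)]) ! (k + m) = e" for \<omega>
    by (cases "m = 0")
      (auto simp: m nth_append first_loop_def nth_path_segment simp del: upt_Suc)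
  then have "\<P>(\<omega> in M. first_loop k r \<omega> \<and> S n \<omega> = e)
    = \<P>(\<omega> in M. first_loop k r \<omega> \<and>
      map (\<lambda>i. S i \<omega>) ([0..<Suc k] @ [Suc (k + r)..<Suc (k + r + m)]) ! (k + m) = e)"
    by (simp only:)
  also have "\<dots> = f r * \<P>(\<omega> in M. path (k + m) \<omega> ! (k + m) = e)"
    by (rule first_loop_excision[OF assms(1)])
  also have "\<dots> = f r * u (n - r)"
    by (simp add: m nth_path_segment return_prob_def del: upt_Suc)
  finally show ?thesis .
qed

text \<open>
  Two loops that do not overlap are excised one after the other, the later one first. Overlapping
  loops admit no such product formula; this is why the variance estimate below works with loops of
  bounded length, for which only nearby base points can interfere.
\<close>

lemma prob_two_first_loops:
  assumes "r \<ge> 1" "q \<ge> 1" "k + r \<le> l" "l + q \<le> n"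
  shows "\<P>(\<omega> in M. first_loop k r \<omega> \<and> first_loop l q \<omega> \<and> S n \<omega> = e) = f r * f q * u (n - r - q)"
proof -
  obtain m where m: "n = l + q + m" using assms(4) by (auto simp: le_iff_add)
  \<comment> \<open>The positions up to \<open>k + r\<close> are not moved by the excision at \<open>l\<close>; the final position moves to index \<open>l + m\<close>.\<close>
  let ?A = "\<lambda>L. (L ! (k + r) = L ! k \<and> (\<forall>j\<in>{1..<r}. L ! (k + j) \<noteq> L ! k)) \<and> L ! (l + m) = e"
  have "first_loop k r \<omega> \<and> first_loop l q \<omega> \<and> S n \<omega> = e \<longleftrightarrow> first_loop l q \<omega> \<and>
      ?A (map (\<lambda>i. S i \<omega>) ([0..<Suc l] @ [Suc (l + q)..<Suc (l + q + m)]))" for \<omega>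
  proof -
    have "map (\<lambda>i. S i \<omega>) ([0..<Suc l] @ [Suc (l + q)..<Suc (l + q + m)]) ! i = S i \<omega>" if "i \<le> l" for i
      using that by (simp add: nth_append nth_path_segment del: upt_Suc)
    moreover have "map (\<lambda>i. S i \<omega>) ([0..<Suc l] @ [Suc (l + q)..<Suc (l + q + m)]) ! (l + m) = S n \<omega>"
      if "first_loop l q \<omega>"
      using that by (cases "m = 0")
        (auto simp: m nth_append first_loop_def nth_path_segment simp del: upt_Suc)
    ultimately show ?thesis
      using assms by (auto simp: first_loop_def simp del: upt_Suc)
  qed
  then have "\<P>(\<omega> in M. first_loop k r \<omega> \<and> first_loop l q \<omega> \<and> S n \<omega> = e)
    = \<P>(\<omega> in M. first_loop l q \<omega> \<and>
      ?A (map (\<lambda>i. S i \<omega>) ([0..<Suc l] @ [Suc (l + q)..<Suc (l + q + m)])))"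
    by (simp only:)
  also have "\<dots> = f q * \<P>(\<omega> in M. ?A (path (l + m) \<omega>))"
    by (rule first_loop_excision[OF assms(2)])
  also have "\<P>(\<omega> in M. ?A (path (l + m) \<omega>)) = \<P>(\<omega> in M. first_loop k r \<omega> \<and> S (l + m) \<omega> = e)"
    using assms by (simp add: first_loop_def nth_path_segment del: upt_Suc)
  also have "\<dots> = f r * u (l + m - r)"
    using assms by (intro prob_first_loop) auto
  finally show ?thesis using assms by (simp add: m mult_ac)
qed

text \<open>
  The first of the returns with length in \<open>I\<close> is a first return, provided that \<open>I\<close> is closed under
  passing to smaller positive lengths. Replacing returns by first returns turns a union of events
  into a disjoint one.
\<close>

lemma ex_first_loop_iff:
  assumes "\<And>r j. r \<in> I \<Longrightarrow> 1 \<le> j \<Longrightarrow> j \<le> r \<Longrightarrow> j \<in> I" "I \<subseteq> {1..}"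
  shows "(\<exists>r\<in>I. S (k + r) \<omega> = S k \<omega>) \<longleftrightarrow> (\<exists>r\<in>I. first_loop k r \<omega>)"
proof
  assume "\<exists>r\<in>I. S (k + r) \<omega> = S k \<omega>"
  then have *: "\<exists>r. r \<in> I \<and> S (k + r) \<omega> = S k \<omega>" by blast
  define r where "r = (LEAST r. r \<in> I \<and> S (k + r) \<omega> = S k \<omega>)"
  have r: "r \<in> I" "S (k + r) \<omega> = S k \<omega>" using LeastI_ex[OF *] unfolding r_def by auto
  have "S (k + j) \<omega> \<noteq> S k \<omega>" if "j \<in> {1..<r}" for j
  proof
    assume "S (k + j) \<omega> = S k \<omega>"
    moreover have "j \<in> I" using assms(1)[OF r(1)] that by auto
    ultimately have "r \<le> j" unfolding r_def by (intro Least_le) auto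
    then show False using that by auto
  qed
  with r have "first_loop k r \<omega>" by (auto simp: first_loop_def)
  with r show "\<exists>r\<in>I. first_loop k r \<omega>" by blast
qed (auto simp: first_loop_def)

lemma first_loop_unique:
  assumes "first_loop k r \<omega>" "first_loop k q \<omega>" "r \<ge> 1" "q \<ge> 1"
  shows "r = q"
  using assms unfolding first_loop_def by (metis atLeastLessThan_iff linorder_neqE_nat)

lemma prob_ex_first_loop:
  assumes "finite I" "I \<subseteq> {1..}" "Measurable.pred M Q"
  shows "\<P>(\<omega> in M. (\<exists>r\<in>I. first_loop k r \<omega>) \<and> Q \<omega>) = (\<Sum>r\<in>I. \<P>(\<omega> in M. first_loop k r \<omega> \<and> Q \<omega>))"
proof -
  note assms(3)[measurable]
  have "prob (\<Union>r\<in>I. {\<omega> \<in> space M. first_loop k r \<omega> \<and> Q \<omega>})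
    = (\<Sum>r\<in>I. \<P>(\<omega> in M. first_loop k r \<omega> \<and> Q \<omega>))"
    using assms(2) first_loop_unique
    by (intro finite_measure_finite_Union assms(1)) (auto simp: disjoint_family_on_def, blast)
  moreover have "(\<Union>r\<in>I. {\<omega> \<in> space M. first_loop k r \<omega> \<and> Q \<omega>})
    = {\<omega> \<in> space M. (\<exists>r\<in>I. first_loop k r \<omega>) \<and> Q \<omega>}" by blast
  ultimately show ?thesis by simp
qed

lemma return_renewal:
  assumes "n \<ge> 1"
  shows "u n = (\<Sum>r = 1..n. f r * u (n - r))"
proof -
  have "u n = \<P>(\<omega> in M. (\<exists>r\<in>{1..n}. first_loop 0 r \<omega>) \<and> S n \<omega> = e)"
    unfolding return_prob_def
  proof (intro prob_eq_AE)
    show "AE \<omega> in M. S n \<omega> = e \<longleftrightarrow> (\<exists>r\<in>{1..n}. first_loop 0 r \<omega>) \<and> S n \<omega> = e"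
      using S_start
    proof eventually_elim
      case (elim \<omega>)
      have "(\<exists>r\<in>{1..n}. first_loop 0 r \<omega>)" if "S n \<omega> = e"
        using that elim assms by (subst ex_first_loop_iff[symmetric]) auto
      then show ?case by blast
    qed
  qed measurable
  also have "\<dots> = (\<Sum>r = 1..n. \<P>(\<omega> in M. first_loop 0 r \<omega> \<and> S n \<omega> = e))"
    by (rule prob_ex_first_loop) auto
  also have "\<dots> = (\<Sum>r = 1..n. f r * u (n - r))"
    by (intro sum.cong refl prob_first_loop) auto
  finally show ?thesis .
qed

text \<open>
  Excising the loop of length \<open>r\<close> at time \<open>0\<close>, with no restriction on what it does in between, leaves
  a loop of length \<open>m\<close>.
\<close>

lemma return_supermult: "u r * u m \<le> u (r + m)"
proof -
  define B where "B b \<longleftrightarrow> b ! r = b ! 0" for b :: "'v list"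
  have "\<P>(\<omega> in M. B (map (\<lambda>i. S i \<omega>) [0..<Suc (0 + r)]) \<and>
      map (\<lambda>i. S i \<omega>) ([0..<Suc 0] @ [Suc (0 + r)..<Suc (0 + r + m)]) ! m = e)
    = \<P>(\<omega> in M. B (path r \<omega>)) * \<P>(\<omega> in M. path (0 + m) \<omega> ! m = e)"
  proof (rule loop_excision)
    fix \<phi> :: "'v \<Rightarrow> 'v" and b :: "'v list"
    assume "inj_on \<phi> V" "length b = Suc r" "set b \<subseteq> V"
    then show "B (map \<phi> b) \<longleftrightarrow> B b" by (auto simp: B_def subset_iff inj_on_eq_iff)
  next
    fix b :: "'v list" assume "length b = Suc r" "B b"
    then show "last b = hd b" by (cases b) (auto simp: B_def last_conv_nth)
  qed
  also have "\<P>(\<omega> in M. B (path r \<omega>)) = u r"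
    unfolding return_prob_def
  proof (intro prob_eq_AE)
    show "AE \<omega> in M. B (path r \<omega>) \<longleftrightarrow> S r \<omega> = e"
      using S_start by eventually_elim (auto simp: B_def nth_path_segment simp del: upt_Suc)
  qed (use path_pred in measurable)
  also have "\<P>(\<omega> in M. path (0 + m) \<omega> ! m = e) = u m"
    by (simp add: return_prob_def nth_path_segment del: upt_Suc)
  finally have "u r * u m = \<P>(\<omega> in M. B (map (\<lambda>i. S i \<omega>) [0..<Suc (0 + r)]) \<and>
      map (\<lambda>i. S i \<omega>) ([0..<Suc 0] @ [Suc (0 + r)..<Suc (0 + r + m)]) ! m = e)" ..
  also have "\<dots> \<le> \<P>(\<omega> in M. S (r + m) \<omega> = e)"
  proof (intro finite_measure_mono_AE)
    show "AE \<omega> in M. \<omega> \<in> {\<omega> \<in> space M. B (map (\<lambda>i. S i \<omega>) [0..<Suc (0 + r)]) \<and>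
        map (\<lambda>i. S i \<omega>) ([0..<Suc 0] @ [Suc (0 + r)..<Suc (0 + r + m)]) ! m = e}
      \<longrightarrow> \<omega> \<in> {\<omega> \<in> space M. S (r + m) \<omega> = e}"
      by (cases "m = 0")
        (auto simp: B_def nth_append nth_path_segment simp del: upt_Suc upt.simps)
  qed measurable
  finally show ?thesis by (simp add: return_prob_def)
qed

text \<open>
  By symmetry of the kernel the first step can be undone with the same positive probability.
\<close>

lemma return_2_pos: "u 2 > 0"
proof -
  obtain y where y: "y \<in> set_pmf (K e)" using set_pmf_not_empty[of "K e"] by blast
  then have yV: "y \<in> V" using K_closed e_in_V by blast
  \<comment> \<open>The path \<open>e, y, e\<close>.\<close>
  define h where "h k = (if k = (1::nat) then y else e)" for k
  have h: "h k \<in> V" for k using yV e_in_V by (simp add: h_def)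
  have "\<P>(\<omega> in M. \<forall>k\<le>0. S k \<omega> = h k) = \<P>(\<omega> in M. True)"
    using S_start by (intro prob_eq_AE) (auto simp: h_def)
  then have "\<P>(\<omega> in M. \<forall>k\<le>0. S k \<omega> = h k) = 1" by (simp add: prob_space)
  then have "\<P>(\<omega> in M. \<forall>k\<le>Suc (Suc 0). S k \<omega> = h k) = pmf (K e) y * pmf (K y) e"
    unfolding S_step[OF h] by (simp add: h_def)
  also have "\<dots> > 0"
    using y K_sym[OF yV e_in_V] by (simp add: pmf_positive)
  also have "\<P>(\<omega> in M. \<forall>k\<le>Suc (Suc 0). S k \<omega> = h k) \<le> u 2"
    unfolding return_prob_def
    by (intro finite_measure_mono) (auto simp: h_def numeral_2_eq_2)
  finally show ?thesis .
qed

sublocale renewal_sequence u f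
proof
  show "u 0 = 1"
  proof -
    have "u 0 = \<P>(\<omega> in M. True)"
      unfolding return_prob_def using S_start by (intro prob_eq_AE) auto
    then show ?thesis by (simp add: prob_space)
  qed
  show "0 \<le> u n" "u n \<le> 1" "0 \<le> f n" for n
    by (simp_all add: return_prob_def first_return_prob_def)
qed (fact return_supermult return_2_pos return_renewal)+

lemma period_eq: "period = walk_period M S e"
  by (simp add: period_def walk_period_def)

end

section \<open>Moments of sums of indicators and the range\<close>

text \<open>
  Chebyshev-type input for counting events whose pairwise intersections are under control only at
  distance at least \<open>L\<close>: the at most \<open>2 * L * N\<close> pairs at smaller distance are estimated by \<open>1\<close>. The centre \<open>c * N\<close> is left
  free because it will be the limiting mean and not the mean itself.
\<close>

lemma (in prob_space) second_moment_indicator_sum: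
  fixes B :: "nat \<Rightarrow> 'a set" and a b c N :: real and m L :: nat
  assumes B: "\<And>k. k < m \<Longrightarrow> B k \<in> events"
    and a: "\<And>k. k < m \<Longrightarrow> prob (B k) = a"
    and b: "\<And>k l. k + L \<le> l \<Longrightarrow> l < m \<Longrightarrow> prob (B k \<inter> B l) = b"
    and "b \<ge> 0" "L \<ge> 1" "real m \<le> N"
  shows "integrable M (\<lambda>\<omega>. ((\<Sum>k<m. indicator (B k) \<omega>) - c * N)\<^sup>2)"
    and "expectation (\<lambda>\<omega>. ((\<Sum>k<m. indicator (B k) \<omega>) - c * N)\<^sup>2)
      \<le> N\<^sup>2 * b + 2 * L * N - 2 * c * N * m * a + c\<^sup>2 * N\<^sup>2"
proof -
  have eq: "((\<Sum>k<m. indicator (B k) \<omega>) - c * N)\<^sup>2 =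
      (\<Sum>k<m. \<Sum>l<m. indicator (B k \<inter> B l) \<omega>) - 2 * c * N * (\<Sum>k<m. indicator (B k) \<omega>) + c\<^sup>2 * N\<^sup>2"
    for \<omega>
    by (simp add: power2_diff power_mult_distrib indicator_inter_arith power2_eq_square[of "sum _ _"]
        sum_product)
  have int1: "integrable M (\<lambda>\<omega>. \<Sum>k<m. indicat_real (B k) \<omega>)"
    using B by (intro Bochner_Integration.integrable_sum) (simp add: emeasure_eq_measure)
  have int2: "integrable M (\<lambda>\<omega>. \<Sum>k<m. \<Sum>l<m. indicat_real (B k \<inter> B l) \<omega>)"
    using B by (intro Bochner_Integration.integrable_sum) (simp add: emeasure_eq_measure)
  show "integrable M (\<lambda>\<omega>. ((\<Sum>k<m. indicator (B k) \<omega>) - c * N)\<^sup>2)"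
    unfolding eq using int1 int2 by simp
  have far: "prob (B k \<inter> B l) \<le> b + indicator {k + 1 - L..<k + L} l" if "k < m" "l < m" for k l
  proof (cases "k + L \<le> l \<or> l + L \<le> k")
    case True
    then have "prob (B k \<inter> B l) = b" using b[of k l] b[of l k] that by (auto simp: Int_commute)
    then show ?thesis by (simp add: indicator_def)
  next
    case False
    then have "l \<in> {k + 1 - L..<k + L}" by auto
    then show ?thesis using \<open>b \<ge> 0\<close> by (simp add: add_increasing)
  qed
  have near: "(\<Sum>l<m. indicat_real {k + 1 - L..<k + L} l) \<le> 2 * real L" for k
  proof -
    have "(\<Sum>l<m. indicat_real {k + 1 - L..<k + L} l) = card ({..<m} \<inter> {k + 1 - L..<k + L})"
      by (simp add: indicator_def flip: sum.inter_filter) (simp add: Int_def)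
    also have "card ({..<m} \<inter> {k + 1 - L..<k + L}) \<le> card {k + 1 - L..<k + L}"
      by (intro card_mono) auto
    also have "\<dots> \<le> 2 * L" by simp
    finally show ?thesis by simp
  qed
  have "(\<Sum>k<m. \<Sum>l<m. prob (B k \<inter> B l)) \<le> (\<Sum>k<m. \<Sum>l<m. b + indicator {k + 1 - L..<k + L} l)"
    by (intro sum_mono far) auto
  also have "\<dots> = (\<Sum>k<m. m * b + (\<Sum>l<m. indicator {k + 1 - L..<k + L} l))"
    by (simp add: sum.distrib)
  also have "\<dots> \<le> (\<Sum>k<m. m * b + 2 * L)"
    by (intro sum_mono add_left_mono) (use near in simp)
  also have "\<dots> = real m * real m * b + 2 * L * m" by (simp add: algebra_simps)
  also have "\<dots> \<le> N * N * b + 2 * L * N"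
    using assms(4,6) by (intro add_mono mult_right_mono mult_mono) (auto intro: mult_left_mono)
  finally have pairs: "(\<Sum>k<m. \<Sum>l<m. prob (B k \<inter> B l)) \<le> N\<^sup>2 * b + 2 * L * N"
    by (simp add: power2_eq_square)
  have "expectation (\<lambda>\<omega>. ((\<Sum>k<m. indicator (B k) \<omega>) - c * N)\<^sup>2)
      = (\<Sum>k<m. \<Sum>l<m. prob (B k \<inter> B l)) - 2 * c * N * (\<Sum>k<m. prob (B k)) + c\<^sup>2 * N\<^sup>2"
  proof -
    have "expectation (\<lambda>\<omega>. \<Sum>k<m. \<Sum>l<m. indicat_real (B k \<inter> B l) \<omega>)
        = (\<Sum>k<m. expectation (\<lambda>\<omega>. \<Sum>l<m. indicat_real (B k \<inter> B l) \<omega>))"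
      using B by (intro Bochner_Integration.integral_sum Bochner_Integration.integrable_sum)
        (simp add: emeasure_eq_measure)
    also have "\<dots> = (\<Sum>k<m. \<Sum>l<m. expectation (indicat_real (B k \<inter> B l)))"
      using B by (intro sum.cong refl Bochner_Integration.integral_sum) (simp add: emeasure_eq_measure)
    also have "\<dots> = (\<Sum>k<m. \<Sum>l<m. prob (B k \<inter> B l))"
      using B by (intro sum.cong refl) simp
    finally have "expectation (\<lambda>\<omega>. \<Sum>k<m. \<Sum>l<m. indicat_real (B k \<inter> B l) \<omega>)
        = (\<Sum>k<m. \<Sum>l<m. prob (B k \<inter> B l))" .
    moreover have "expectation (\<lambda>\<omega>. \<Sum>k<m. indicat_real (B k) \<omega>) = (\<Sum>k<m. prob (B k))"
      using B by (simp add: emeasure_eq_measure)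
    ultimately show ?thesis unfolding eq using int1 int2 by (simp add: prob_space)
  qed
  also have "(\<Sum>k<m. prob (B k)) = m * a" using a by simp
  finally show "expectation (\<lambda>\<omega>. ((\<Sum>k<m. indicator (B k) \<omega>) - c * N)\<^sup>2)
      \<le> N\<^sup>2 * b + 2 * L * N - 2 * c * N * m * a + c\<^sup>2 * N\<^sup>2"
    using pairs by (simp add: mult_ac)
qed

lemma (in prob_space) prob_indicator_sum_gt:
  fixes d t :: real
  assumes D: "\<And>k. k \<in> J \<Longrightarrow> D k \<in> events" and le: "\<And>k. k \<in> J \<Longrightarrow> prob (D k) \<le> d"
    and "t > 0"
  shows "prob {\<omega> \<in> space M. (\<Sum>k\<in>J. indicat_real (D k) \<omega>) > t} \<le> card J * d / t"
proof -
  have int: "integrable M (\<lambda>\<omega>. \<Sum>k\<in>J. indicat_real (D k) \<omega>)"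
    using D by (intro Bochner_Integration.integrable_sum) (simp add: emeasure_eq_measure)
  have "prob {\<omega> \<in> space M. (\<Sum>k\<in>J. indicat_real (D k) \<omega>) > t}
      \<le> prob {\<omega> \<in> space M. (\<Sum>k\<in>J. indicat_real (D k) \<omega>) \<ge> t}"
    using borel_measurable_integrable[OF int] by (intro finite_measure_mono) auto
  also have "\<dots> \<le> expectation (\<lambda>\<omega>. \<Sum>k\<in>J. indicat_real (D k) \<omega>) / t"
    using \<open>t > 0\<close> by (intro integral_Markov_inequality_measure[OF int, of "{}"]) (auto intro!: sum_nonneg)
  also have "expectation (\<lambda>\<omega>. \<Sum>k\<in>J. indicat_real (D k) \<omega>) = (\<Sum>k\<in>J. prob (D k))"
    using D by (simp add: emeasure_eq_measure)
  also have "\<dots> / t \<le> card J * d / t"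
    using sum_bounded_above[of J "\<lambda>k. prob (D k)" d] le \<open>t > 0\<close> by (intro divide_right_mono) auto
  finally show ?thesis .
qed

text \<open>
  The range counts each visited vertex at its last visit before time \<open>n\<close>, so its complement in \<open>n\<close>
  counts the times \<open>k\<close> at which the current vertex will be visited again before time \<open>n\<close>.
\<close>

lemma walk_range_eq:
  "real (walk_range S n \<omega>) =
    real n - (\<Sum>k<n. indicator {\<omega>. \<exists>r\<in>{1..<n - k}. S (k + r) \<omega> = S k \<omega>} \<omega>)"
proof -
  define R where "R = {k \<in> {..<n}. \<exists>r\<in>{1..<n - k}. S (k + r) \<omega> = S k \<omega>}"
  have inj: "inj_on (\<lambda>k. S k \<omega>) ({..<n} - R)"
  proof (rule linorder_inj_onI')
    fix i j assume ij: "i \<in> {..<n} - R" "j \<in> {..<n} - R" "i < j"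
    then have "j - i \<in> {1..<n - i}" by auto
    then have "S (i + (j - i)) \<omega> \<noteq> S i \<omega>" using ij(1) unfolding R_def by blast
    then show "S i \<omega> \<noteq> S j \<omega>" using ij(3) by simp
  qed
  have "\<exists>j\<in>{..<n} - R. S k \<omega> = S j \<omega>" if "k < n" for k
  proof -
    let ?P = "\<lambda>j. j < n \<and> S j \<omega> = S k \<omega>"
    define j where "j = Greatest ?P"
    have P: "?P j" unfolding j_def by (rule GreatestI_nat[of ?P k n]) (use that in auto)
    have "j \<notin> R"
    proof
      assume "j \<in> R"
      then obtain r where r: "1 \<le> r" "r < n - j" "S (j + r) \<omega> = S j \<omega>" by (auto simp: R_def)
      then have "?P (j + r)" using P by auto
      then have "j + r \<le> j" unfolding j_def by (rule Greatest_le_nat[of ?P _ n]) auto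
      then show False using r by simp
    qed
    with P show ?thesis by (intro bexI[of _ j]) auto
  qed
  then have "(\<lambda>k. S k \<omega>) ` {..<n} = (\<lambda>k. S k \<omega>) ` ({..<n} - R)" by blast
  then have "walk_range S n \<omega> = card ({..<n} - R)"
    by (simp add: walk_range_def card_image[OF inj])
  moreover have "R \<subseteq> {..<n}" by (auto simp: R_def)
  ultimately have "walk_range S n \<omega> = n - card R" "card R \<le> n"
    using card_mono[of "{..<n}" R] by (auto simp: card_Diff_subset finite_subset)
  moreover have "real (card R) = (\<Sum>k<n. indicator {\<omega>. \<exists>r\<in>{1..<n - k}. S (k + r) \<omega> = S k \<omega>} \<omega>)"
    by (auto simp: R_def indicator_def intro!: arg_cong[of _ _ card] simp flip: sum.inter_filter)
  ultimately show ?thesis by simp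
qed

section \<open>Concentration of the range of the bridge\<close>

context transitive_walk
begin

text \<open>
  Given a return to \<open>e\<close> at time \<open>n\<close>, the conditional probability that the walk returns within \<open>L\<close>
  steps to its position at a given time is \<open>once_loop L n\<close>, and \<open>twice_loop L n\<close> is the conditional
  probability that it does so from each of two given times at distance at least \<open>L\<close>. Neither
  depends on the given times, as long as the loops end by time \<open>n\<close>.
\<close>

definition once_loop :: "nat \<Rightarrow> nat \<Rightarrow> real" where
  "once_loop L n = (\<Sum>r = 1..L. f r * u (n - r)) / u n"

definition twice_loop :: "nat \<Rightarrow> nat \<Rightarrow> real" where
  "twice_loop L n = (\<Sum>r = 1..L. \<Sum>q = 1..L. f r * f q * u (n - r - q)) / u n"

definition F_upto :: "nat \<Rightarrow> real" where "F_upto L = (\<Sum>r = 1..L. f r * \<rho> ^ r)"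

text \<open>
  The quantitative core. Let \<open>W\<close> be the number of times at which the current vertex is visited again
  before time \<open>n\<close>, and let \<open>T\<close> count only the revisits within \<open>L\<close> steps. Under the bridge law \<open>Q\<close>, the
  count \<open>T\<close> concentrates by the second moment method, and its mean is governed by loops of length at
  most \<open>L\<close>. The difference \<open>W - T\<close> is small in mean: a first return of length \<open>r > L\<close> has conditional
  probability \<open>f r * u (n - r) / u n\<close>, which the domination hypothesis compares with the tail of
  \<open>F(\<rho>)\<close>. That hypothesis is limited to \<open>r < (1 - \<delta>) * n\<close>, so the first \<open>\<delta> * n\<close> times, whose loops may
  be longer, are simply discarded, as are the last \<open>L\<close> times.

  The deviation \<open>5 * \<delta>\<close> is made up of \<open>\<delta>\<close> for each of: the fluctuation of \<open>T\<close>, the discarded initial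
  times, the discarded end times together with rounding, the long loops, and the gap between
  \<open>F(\<rho>)\<close> and its partial sum.
\<close>

lemma bridge_deviation_bound:
  assumes un: "u n > 0" and L: "1 \<le> L" "L < n" and \<delta>: "\<delta> > 0"
    and tail: "F_rho - F_upto L \<le> \<delta>" and small: "1 + real L \<le> \<delta> * n"
    and C: "C \<ge> 0" "\<And>r. 1 \<le> r \<Longrightarrow> real r < (1 - \<delta>) * n \<Longrightarrow> period dvd r \<Longrightarrow> u (n - r) \<le> C * \<rho> ^ r * u n"
  shows "\<P>(\<omega> in M. \<bar>real (walk_range S n \<omega>) / n - (1 - F_rho)\<bar> > 5 * \<delta> \<bar> S n \<omega> = e)
    \<le> (twice_loop L n + 2 * real L / n - 2 * F_upto L * ((real n - real L) / n) * once_loop L n + (F_upto L)\<^sup>2) / \<delta>\<^sup>2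
      + C * (F_rho - F_upto L) / \<delta>"
proof -
  define E where "E = {\<omega> \<in> space M. S n \<omega> = e}"
  define Q where "Q = uniform_measure M E"
  have E [measurable]: "E \<in> events" unfolding E_def by measurable
  have prob_E: "prob E = u n" by (simp add: E_def return_prob_def)
  have E_nz: "emeasure M E \<noteq> 0" using un by (simp add: emeasure_eq_measure prob_E)
  interpret Q: prob_space Q
    unfolding Q_def using E_nz by (intro prob_space_uniform_measure) (auto simp: emeasure_eq_measure)
  have space_Q [simp]: "space Q = space M" and sets_Q [simp, measurable_cong]: "sets Q = sets M"
    by (simp_all add: Q_def)
  have Q_prob: "Q.prob {\<omega> \<in> space M. P \<omega>} = \<P>(\<omega> in M. P \<omega> \<and> S n \<omega> = e) / u n"
    if [measurable]: "Measurable.pred M P" for P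
  proof -
    have "Q.prob {\<omega> \<in> space M. P \<omega>} = prob (E \<inter> {\<omega> \<in> space M. P \<omega>}) / prob E"
      unfolding Q_def using E_nz by (intro measure_uniform_measure) (auto simp: emeasure_eq_measure)
    also have "E \<inter> {\<omega> \<in> space M. P \<omega>} = {\<omega> \<in> space M. P \<omega> \<and> S n \<omega> = e}" by (auto simp: E_def)
    finally show ?thesis by (simp add: prob_E)
  qed
  \<comment> \<open>Base points below \<open>m\<close> leave room for a loop of length \<open>L\<close> before time \<open>n\<close>.\<close>
  define m where "m = n - L"
  define B where "B k = {\<omega> \<in> space M. \<exists>r\<in>{1..L}. first_loop k r \<omega>}" for k
  define T where "T \<omega> = (\<Sum>k<m. indicat_real (B k) \<omega>)" for \<omega>
  define J where "J = {k. k < m \<and> \<delta> * n \<le> k}"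
  define D where "D k = {\<omega> \<in> space M. \<exists>r\<in>{L<..<n - k}. first_loop k r \<omega>}" for k
  define W where "W \<omega> = (\<Sum>k<n. indicat_real {\<omega>. \<exists>r\<in>{1..<n - k}. S (k + r) \<omega> = S k \<omega>} \<omega>)" for \<omega>
  have [measurable]: "B k \<in> events" "D k \<in> events" for k unfolding B_def D_def by measurable
  have T_meas [measurable]: "T \<in> borel_measurable M" unfolding T_def by measurable
  have F0: "0 \<le> F_upto L" unfolding F_upto_def using F_term_nonneg by (intro sum_nonneg)
  have tail0: "0 \<le> F_rho - F_upto L" using F_partial_le_F[of L] by (simp add: F_upto_def)

  have QB: "Q.prob (B k) = once_loop L n" if "k < m" for k
  proof -
    have "Q.prob (B k) = \<P>(\<omega> in M. (\<exists>r\<in>{1..L}. first_loop k r \<omega>) \<and> S n \<omega> = e) / u n"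
      unfolding B_def by (intro Q_prob) measurable
    also have "\<P>(\<omega> in M. (\<exists>r\<in>{1..L}. first_loop k r \<omega>) \<and> S n \<omega> = e)
        = (\<Sum>r = 1..L. \<P>(\<omega> in M. first_loop k r \<omega> \<and> S n \<omega> = e))"
      by (intro prob_ex_first_loop) auto
    also have "\<dots> = (\<Sum>r = 1..L. f r * u (n - r))"
      using that by (intro sum.cong refl prob_first_loop) (auto simp: m_def)
    finally show ?thesis by (simp add: once_loop_def)
  qed
  have QBB: "Q.prob (B k \<inter> B l) = twice_loop L n" if kl: "k + L \<le> l" "l < m" for k l
  proof -
    have "B k \<inter> B l = {\<omega> \<in> space M. (\<exists>r\<in>{1..L}. first_loop k r \<omega>) \<and> (\<exists>q\<in>{1..L}. first_loop l q \<omega>)}"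
      by (auto simp: B_def)
    also have "Q.prob \<dots> = \<P>(\<omega> in M. ((\<exists>r\<in>{1..L}. first_loop k r \<omega>) \<and> (\<exists>q\<in>{1..L}. first_loop l q \<omega>))
        \<and> S n \<omega> = e) / u n"
      by (intro Q_prob) measurable
    also have "\<P>(\<omega> in M. ((\<exists>r\<in>{1..L}. first_loop k r \<omega>) \<and> (\<exists>q\<in>{1..L}. first_loop l q \<omega>)) \<and> S n \<omega> = e)
        = (\<Sum>r = 1..L. \<P>(\<omega> in M. first_loop k r \<omega> \<and> (\<exists>q\<in>{1..L}. first_loop l q \<omega>) \<and> S n \<omega> = e))"
      unfolding conj_assoc by (intro prob_ex_first_loop) auto
    also have "\<dots> = (\<Sum>r = 1..L. \<P>(\<omega> in M. (\<exists>q\<in>{1..L}. first_loop l q \<omega>) \<and> (first_loop k r \<omega> \<and> S n \<omega> = e)))"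
      by (simp only: conj_left_commute)
    also have "\<dots> = (\<Sum>r = 1..L. \<Sum>q = 1..L. \<P>(\<omega> in M. first_loop l q \<omega> \<and> (first_loop k r \<omega> \<and> S n \<omega> = e)))"
      by (intro sum.cong refl prob_ex_first_loop) auto
    also have "\<dots> = (\<Sum>r = 1..L. \<Sum>q = 1..L. f r * f q * u (n - r - q))"
    proof (intro sum.cong refl)
      fix r q assume rq: "r \<in> {1..L}" "q \<in> {1..L}"
      then have "l + q \<le> n" using kl by (auto simp: m_def)
      with rq show "\<P>(\<omega> in M. first_loop l q \<omega> \<and> (first_loop k r \<omega> \<and> S n \<omega> = e)) = f r * f q * u (n - r - q)"
        using kl prob_two_first_loops[of r q k l n] by (simp add: m_def conj_left_commute)
    qed
    finally show ?thesis by (simp add: twice_loop_def)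
  qed
  have QD: "Q.prob (D k) \<le> C * (F_rho - F_upto L)" if "k \<in> J" for k
  proof -
    have kn: "k < n" "\<delta> * n \<le> k" using that by (auto simp: J_def m_def)
    have QD_eq: "Q.prob (D k) = \<P>(\<omega> in M. (\<exists>r\<in>{L<..<n - k}. first_loop k r \<omega>) \<and> S n \<omega> = e) / u n"
      unfolding D_def by (intro Q_prob) measurable
    have "\<P>(\<omega> in M. (\<exists>r\<in>{L<..<n - k}. first_loop k r \<omega>) \<and> S n \<omega> = e)
        = (\<Sum>r\<in>{L<..<n - k}. \<P>(\<omega> in M. first_loop k r \<omega> \<and> S n \<omega> = e))"
      by (intro prob_ex_first_loop) auto
    also have "\<dots> = (\<Sum>r\<in>{L<..<n - k}. f r * u (n - r))"
      by (intro sum.cong refl prob_first_loop) auto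
    also have "\<dots> \<le> (\<Sum>r\<in>{L<..<n - k}. C * u n * (f r * \<rho> ^ r))"
    proof (rule sum_mono)
      fix r assume r: "r \<in> {L<..<n - k}"
      show "f r * u (n - r) \<le> C * u n * (f r * \<rho> ^ r)"
      proof (cases "period dvd r")
        case True
        have "real r < real n - real k" using r by auto
        also have "\<dots> \<le> (1 - \<delta>) * n" using kn by (simp add: algebra_simps)
        finally have "u (n - r) \<le> C * \<rho> ^ r * u n" using True r by (intro C) auto
        then have "f r * u (n - r) \<le> f r * (C * \<rho> ^ r * u n)"
          by (intro mult_left_mono) (auto simp: f_nonneg)
        then show ?thesis by (simp add: mult_ac)
      next
        case False
        then show ?thesis using period_dvd_f[of r] r by simp
      qed
    qed
    also have "\<dots> = C * u n * (\<Sum>r\<in>{L<..<n - k}. f r * \<rho> ^ r)" by (rule sum_distrib_left[symmetric])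
    also have "\<dots> \<le> C * u n * (F_rho - F_upto L)"
      using C(1) un F_block_le[of L "n - k"] by (intro mult_left_mono) (auto simp: F_upto_def)
    finally show ?thesis unfolding QD_eq using un by (simp add: pos_divide_le_eq mult_ac)
  qed

  have sum_le: "W \<omega> - T \<omega> \<le> 2 * \<delta> * n + (\<Sum>k\<in>J. indicat_real (D k) \<omega>)" "T \<omega> \<le> W \<omega>"
    if \<omega>: "\<omega> \<in> space M" for \<omega>
  proof -
    let ?c = "\<lambda>k. indicat_real {\<omega>. \<exists>r\<in>{1..<n - k}. S (k + r) \<omega> = S k \<omega>} \<omega>"
    have c: "?c k = indicat_real {\<omega>. \<exists>r\<in>{1..<n - k}. first_loop k r \<omega>} \<omega>" for k
      by (subst ex_first_loop_iff) auto
    have split: "W \<omega> = (\<Sum>k<m. ?c k) + (\<Sum>k\<in>{m..<n}. ?c k)"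
      unfolding W_def by (subst sum.union_disjoint[symmetric]) (auto simp: m_def intro!: sum.cong)
    have "(\<Sum>k\<in>{m..<n}. ?c k) \<le> (\<Sum>k\<in>{m..<n}. 1)"
      by (intro sum_mono) (auto simp: indicator_def)
    also have "\<dots> = L" using L by (simp add: m_def)
    finally have end_le: "(\<Sum>k\<in>{m..<n}. ?c k) \<le> L" .
    have B_le: "indicat_real (B k) \<omega> \<le> ?c k" if "k < m" for k
    proof -
      have "{1..L} \<subseteq> {1..<n - k}" using that by (auto simp: m_def)
      then have "\<exists>r\<in>{1..<n - k}. first_loop k r \<omega>" if "\<omega> \<in> B k"
        using that unfolding B_def by blast
      then show ?thesis unfolding c by (auto simp: indicator_def)
    qed
    have "T \<omega> \<le> (\<Sum>k<m. ?c k)" unfolding T_def by (intro sum_mono B_le) auto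
    also have "\<dots> \<le> W \<omega>" unfolding split by (auto intro!: sum_nonneg)
    finally show "T \<omega> \<le> W \<omega>" .
    have "(\<Sum>k<m. ?c k) - T \<omega> = (\<Sum>k<m. ?c k - indicat_real (B k) \<omega>)"
      unfolding T_def by (rule sum_subtractf[symmetric])
    also have "\<dots> \<le> (\<Sum>k<m. (if k \<in> J then indicat_real (D k) \<omega> else 1))"
    proof (rule sum_mono)
      fix k assume "k \<in> {..<m}"
      have "?c k \<le> indicat_real (B k) \<omega> + indicat_real (D k) \<omega>"
        using \<omega> unfolding c B_def D_def by (auto simp: indicator_def)
      moreover have "?c k \<le> 1" "0 \<le> indicat_real (B k) \<omega>" by (auto simp: indicator_def)
      ultimately show "?c k - indicat_real (B k) \<omega> \<le> (if k \<in> J then indicat_real (D k) \<omega> else 1)"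
        by (smt (verit))
    qed
    also have "\<dots> = (\<Sum>k\<in>{..<m} \<inter> J. indicat_real (D k) \<omega>) + real (card ({..<m} - J))"
      by (simp add: sum.If_cases Diff_eq)
    also have "{..<m} \<inter> J = J" by (auto simp: J_def)
    also have "real (card ({..<m} - J)) \<le> \<delta> * n + 1"
    proof -
      have "{..<m} - J \<subseteq> {..<nat \<lceil>\<delta> * n\<rceil>}"
      proof
        fix k assume "k \<in> {..<m} - J"
        then have "real k < \<delta> * n" by (auto simp: J_def)
        then show "k \<in> {..<nat \<lceil>\<delta> * n\<rceil>}" unfolding lessThan_iff by linarith
      qed
      then have "card ({..<m} - J) \<le> nat \<lceil>\<delta> * n\<rceil>"
        using card_mono[of "{..<nat \<lceil>\<delta> * n\<rceil>}"] by fastforce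
      then have "real (card ({..<m} - J)) \<le> real (nat \<lceil>\<delta> * n\<rceil>)" by simp
      also have "\<dots> = \<lceil>\<delta> * n\<rceil>" using \<delta> by (intro of_nat_nat) (simp add: less_le_trans[of "-1" 0])
      also have "\<dots> \<le> \<delta> * n + 1" by linarith
      finally show ?thesis .
    qed
    finally show "W \<omega> - T \<omega> \<le> 2 * \<delta> * n + (\<Sum>k\<in>J. indicat_real (D k) \<omega>)"
      using split end_le small by linarith
  qed

  let ?bad = "{\<omega> \<in> space M. \<bar>real (walk_range S n \<omega>) / n - (1 - F_rho)\<bar> > 5 * \<delta>}"
  let ?bad1 = "{\<omega> \<in> space Q. (\<delta> * n)\<^sup>2 \<le> (T \<omega> - F_upto L * n)\<^sup>2}"
  let ?bad2 = "{\<omega> \<in> space Q. (\<Sum>k\<in>J. indicat_real (D k) \<omega>) > \<delta> * n}"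
  have n0: "real n > 0" using L by simp
  have range_W: "real (walk_range S n \<omega>) = real n - W \<omega>" for \<omega>
    unfolding W_def by (rule walk_range_eq)
  have bad_sub: "?bad \<subseteq> ?bad1 \<union> ?bad2"
  proof
    fix \<omega> assume "\<omega> \<in> ?bad"
    then have \<omega>: "\<omega> \<in> space M" and dev: "5 * \<delta> < \<bar>real (walk_range S n \<omega>) / n - (1 - F_rho)\<bar>"
      by auto
    have "real (walk_range S n \<omega>) / n - (1 - F_rho) = (F_rho * n - W \<omega>) / n"
      using n0 by (simp add: range_W field_simps)
    with dev have "5 * \<delta> < \<bar>F_rho * n - W \<omega>\<bar> / n" using n0 by (simp add: abs_divide)
    then have dev: "5 * (\<delta> * n) < \<bar>F_rho * n - W \<omega>\<bar>" using n0 by (simp add: field_simps)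
    have tail_n: "F_upto L * n \<le> F_rho * n" "F_rho * n - F_upto L * n \<le> \<delta> * n"
      using n0 tail tail0 by (simp_all flip: left_diff_distrib)
    show "\<omega> \<in> ?bad1 \<union> ?bad2"
    proof (rule ccontr)
      assume not_bad: "\<omega> \<notin> ?bad1 \<union> ?bad2"
      then have "\<bar>T \<omega> - F_upto L * n\<bar> < \<delta> * n"
        using \<omega> n0 \<delta> power2_le_iff_abs_le[of "\<delta> * n"] abs_le_square_iff[of "\<delta> * n" "T \<omega> - F_upto L * n"]
        by (auto simp: not_le)
      moreover have "(\<Sum>k\<in>J. indicat_real (D k) \<omega>) \<le> \<delta> * n" using not_bad \<omega> by auto
      ultimately show False using sum_le[OF \<omega>] dev tail_n by (simp add: abs_if split: if_splits)
    qed
  qed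
  have "\<P>(\<omega> in M. \<bar>real (walk_range S n \<omega>) / n - (1 - F_rho)\<bar> > 5 * \<delta> \<bar> S n \<omega> = e) = Q.prob ?bad"
  proof -
    have [measurable]: "W \<in> borel_measurable M"
      unfolding W_def by measurable
    have "Q.prob ?bad = \<P>(\<omega> in M. \<bar>real (walk_range S n \<omega>) / n - (1 - F_rho)\<bar> > 5 * \<delta> \<and> S n \<omega> = e) / u n"
      unfolding range_W by (intro Q_prob) measurable
    then show ?thesis by (simp add: cond_prob_def return_prob_def)
  qed
  also have "\<dots> \<le> Q.prob (?bad1 \<union> ?bad2)"
    by (intro Q.finite_measure_mono bad_sub) measurable
  also have "\<dots> \<le> Q.prob ?bad1 + Q.prob ?bad2"
    by (intro measure_Un_le) measurable
  also have "Q.prob ?bad1 \<le> (twice_loop L n + 2 * real L / n - 2 * F_upto L * ((real n - real L) / n) * once_loop L n + (F_upto L)\<^sup>2) / \<delta>\<^sup>2"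
  proof -
    have b0: "twice_loop L n \<ge> 0"
      unfolding twice_loop_def using un by (intro divide_nonneg_pos sum_nonneg) (auto simp: f_nonneg u_nonneg)
    note moment = Q.second_moment_indicator_sum[where B = B and m = m and L = L and c = "F_upto L" and N = n,
        OF _ QB QBB b0 L(1), folded T_def]
    have int: "integrable Q (\<lambda>\<omega>. (T \<omega> - F_upto L * n)\<^sup>2)"
      by (rule moment(1)) (auto simp: m_def)
    have le: "Q.expectation (\<lambda>\<omega>. (T \<omega> - F_upto L * n)\<^sup>2)
      \<le> (real n)\<^sup>2 * twice_loop L n + 2 * L * real n - 2 * F_upto L * n * m * once_loop L n + (F_upto L)\<^sup>2 * (real n)\<^sup>2"
      by (rule moment(2)) (auto simp: m_def)
    have "Q.prob ?bad1 \<le> Q.expectation (\<lambda>\<omega>. (T \<omega> - F_upto L * n)\<^sup>2) / (\<delta> * n)\<^sup>2"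
      using \<delta> n0 by (intro integral_Markov_inequality_measure[OF int, of "{}"]) auto
    also have "\<dots> \<le> ((real n)\<^sup>2 * twice_loop L n + 2 * L * real n - 2 * F_upto L * n * m * once_loop L n
        + (F_upto L)\<^sup>2 * (real n)\<^sup>2) / (\<delta> * n)\<^sup>2"
      by (intro divide_right_mono le) auto
    also have "\<dots> = (twice_loop L n + 2 * real L / n - 2 * F_upto L * ((real n - real L) / n) * once_loop L n + (F_upto L)\<^sup>2) / \<delta>\<^sup>2"
      using n0 \<delta> L by (simp add: m_def of_nat_diff field_simps power2_eq_square)
    finally show ?thesis .
  qed
  also have "Q.prob ?bad2 \<le> C * (F_rho - F_upto L) / \<delta>"
  proof -
    have "Q.prob ?bad2 \<le> card J * (C * (F_rho - F_upto L)) / (\<delta> * n)"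
      using \<delta> n0 by (intro Q.prob_indicator_sum_gt QD) auto
    also have "\<dots> \<le> n * (C * (F_rho - F_upto L)) / (\<delta> * n)"
    proof -
      have "card J \<le> card {..<n}" by (intro card_mono) (auto simp: J_def m_def)
      then show ?thesis
        using C(1) tail0 \<delta> by (intro divide_right_mono mult_right_mono) auto
    qed
    also have "\<dots> = C * (F_rho - F_upto L) / \<delta>" using n0 by simp
    finally show ?thesis .
  qed
  finally show ?thesis by simp
qed

lemma filterlim_multiples: "filterlim (\<lambda>n. period * n) (multiples_at_top period) sequentially"
  unfolding multiples_at_top_def
proof (intro filterlim_inf[THEN iffD2] conjI)
  show "filterlim (\<lambda>n. period * n) sequentially sequentially"
    using period_pos by (intro filterlim_subseq) (auto simp: strict_mono_def)
qed (auto simp: filterlim_principal)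

lemma shifted_return_tendsto:
  assumes "\<forall>r. period dvd r \<longrightarrow> ((\<lambda>n. u (n - r) / (\<rho> ^ r * u n)) \<longlongrightarrow> 1) (multiples_at_top period)"
    and "period dvd r"
  shows "(\<lambda>n. u (period * n - r) / u (period * n)) \<longlonglongrightarrow> \<rho> ^ r"
proof -
  have "(\<lambda>n. \<rho> ^ r * (u (period * n - r) / (\<rho> ^ r * u (period * n)))) \<longlonglongrightarrow> \<rho> ^ r * 1"
    using filterlim_compose[OF _ filterlim_multiples] assms by (intro tendsto_mult tendsto_const) blast
  then show ?thesis using rho_ge_1 by simp
qed

text \<open>
  In \<open>bridge_deviation_bound\<close> the parameters are chosen one after the other: \<open>\<delta>\<close> from the deviation,
  then the constant \<open>C\<close> from the domination hypothesis for \<open>\<delta>\<close>, then \<open>L\<close> so large that the tail of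
  \<open>F(\<rho>)\<close> beats \<open>C\<close>, and finally \<open>n \<rightarrow> \<infinity>\<close>. For fixed \<open>L\<close> the ratio hypothesis turns the conditional
  probabilities of one and of two separated short loops into a partial sum of \<open>F(\<rho>)\<close> and its
  square, so that the second moment term vanishes in the limit.
\<close>

theorem bridge_range_tendsto:
  assumes H1: "\<forall>\<eta>::real. 0 < \<eta> \<and> \<eta> < 1 \<longrightarrow>
         Limsup (multiples_at_top period)
           (\<lambda>n. SUP r \<in> {r. 1 \<le> r \<and> real r < (1 - \<eta>) * real n \<and> period dvd r}.
                  ereal (u (n - r) / (\<rho> ^ r * u n))) < \<infinity>"
    and H2: "\<forall>r. period dvd r \<longrightarrow>
         ((\<lambda>n. u (n - r) / (\<rho> ^ r * u n)) \<longlongrightarrow> 1) (multiples_at_top period)"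
    and \<epsilon>: "\<epsilon> > 0"
  shows "(\<lambda>n. \<P>(\<omega> in M. \<bar>real (walk_range S (period * n) \<omega>) / real (period * n) - (1 - F_rho)\<bar> > \<epsilon>
                  \<bar> S (period * n) \<omega> = e)) \<longlonglongrightarrow> 0"
    (is "?prob \<longlonglongrightarrow> 0")
proof (rule order_tendstoI)
  fix a :: real assume "a < 0"
  then show "eventually (\<lambda>n. a < ?prob n) sequentially"
    by (auto simp: cond_prob_def intro!: always_eventually less_le_trans[OF _ divide_nonneg_nonneg])
next
  fix \<kappa> :: real assume \<kappa>: "0 < \<kappa>"
  define \<delta> where "\<delta> = min (\<epsilon> / 5) (1 / 2)"
  have \<delta>: "0 < \<delta>" "\<delta> < 1" "5 * \<delta> \<le> \<epsilon>" using \<epsilon> by (auto simp: \<delta>_def)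
  let ?sup = "\<lambda>n. SUP r \<in> {r. 1 \<le> r \<and> real r < (1 - \<delta>) * real n \<and> period dvd r}.
                  ereal (u (n - r) / (\<rho> ^ r * u n))"
  obtain C0 where C0: "Limsup (multiples_at_top period) ?sup < ereal C0"
    using H1 \<delta> ereal_dense2[of "Limsup (multiples_at_top period) ?sup" \<infinity>] by blast
  define C where "C = max C0 1"
  have "eventually (\<lambda>n. ?sup n < ereal C0) (multiples_at_top period)"
    by (rule Limsup_lessD[OF C0])
  then have ev_sup: "eventually (\<lambda>n. ?sup (period * n) < ereal C0) sequentially"
    using filterlim_multiples unfolding filterlim_iff by blast
  have "eventually (\<lambda>L. F_rho - F_upto L < min \<delta> (\<kappa> * \<delta> / (2 * C))) sequentially"
  proof (rule order_tendstoD(2))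
    show "(\<lambda>L. F_rho - F_upto L) \<longlonglongrightarrow> F_rho - F_rho"
      unfolding F_upto_def by (intro tendsto_diff tendsto_const F_partial_tendsto)
    show "F_rho - F_rho < min \<delta> (\<kappa> * \<delta> / (2 * C))" using \<kappa> \<delta> by (auto simp: C_def)
  qed
  then obtain L where L: "L \<ge> 1" "F_rho - F_upto L < min \<delta> (\<kappa> * \<delta> / (2 * C))"
    using eventually_happens[OF eventually_conj[OF _ eventually_ge_at_top[of 1]]]
    by (metis (no_types, lifting) trivial_limit_sequentially)
  let ?V = "\<lambda>n. twice_loop L n + 2 * real L / n - 2 * F_upto L * ((real n - real L) / n) * once_loop L n + (F_upto L)\<^sup>2"
  have once: "(\<lambda>n. once_loop L (period * n)) \<longlonglongrightarrow> F_upto L"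
  proof -
    have "(\<lambda>n. f r * (u (period * n - r) / u (period * n))) \<longlonglongrightarrow> f r * \<rho> ^ r" if "r \<in> {1..L}" for r
    proof (cases "period dvd r")
      case True
      then show ?thesis by (intro tendsto_mult tendsto_const shifted_return_tendsto[OF H2])
    next
      case False
      then show ?thesis using that period_dvd_f[of r] by simp
    qed
    then have "(\<lambda>n. \<Sum>r = 1..L. f r * (u (period * n - r) / u (period * n))) \<longlonglongrightarrow> F_upto L"
      unfolding F_upto_def by (rule tendsto_sum)
    then show ?thesis by (simp add: once_loop_def sum_divide_distrib)
  qed
  have twice: "(\<lambda>n. twice_loop L (period * n)) \<longlonglongrightarrow> F_upto L * F_upto L"
  proof -
    have "(\<lambda>n. f r * f q * (u (period * n - (r + q)) / u (period * n))) \<longlonglongrightarrow> f r * f q * \<rho> ^ (r + q)"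
      if "r \<in> {1..L}" "q \<in> {1..L}" for r q
    proof (cases "period dvd r \<and> period dvd q")
      case True
      then show ?thesis by (intro tendsto_mult tendsto_const shifted_return_tendsto[OF H2]) auto
    next
      case False
      then have "f r * f q = 0" using that period_dvd_f[of r] period_dvd_f[of q] by auto
      then show ?thesis by auto
    qed
    then have "(\<lambda>n. \<Sum>r = 1..L. \<Sum>q = 1..L. f r * f q * (u (period * n - (r + q)) / u (period * n)))
        \<longlonglongrightarrow> (\<Sum>r = 1..L. \<Sum>q = 1..L. f r * f q * \<rho> ^ (r + q))"
      by (intro tendsto_sum)
    also have "(\<Sum>r = 1..L. \<Sum>q = 1..L. f r * f q * \<rho> ^ (r + q)) = F_upto L * F_upto L"
      by (simp add: F_upto_def sum_product power_add mult_ac)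
    finally show ?thesis by (simp add: twice_loop_def sum_divide_distrib)
  qed
  have inv: "(\<lambda>n. 1 / real (period * n)) \<longlonglongrightarrow> 0"
    by (rule real_tendsto_divide_at_top[OF tendsto_const period_times_at_top])
  have "(\<lambda>n. twice_loop L (period * n) + 2 * real L * (1 / real (period * n))
      - 2 * F_upto L * (1 - real L * (1 / real (period * n))) * once_loop L (period * n) + (F_upto L)\<^sup>2)
      \<longlonglongrightarrow> F_upto L * F_upto L + 2 * real L * 0 - 2 * F_upto L * (1 - real L * 0) * F_upto L + (F_upto L)\<^sup>2"
    by (intro tendsto_intros inv once twice)
  then have "(\<lambda>n. twice_loop L (period * n) + 2 * real L * (1 / real (period * n))
      - 2 * F_upto L * (1 - real L * (1 / real (period * n))) * once_loop L (period * n) + (F_upto L)\<^sup>2) \<longlonglongrightarrow> 0"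
    by (simp add: power2_eq_square)
  then have ev_V: "eventually (\<lambda>n. twice_loop L (period * n) + 2 * real L * (1 / real (period * n))
      - 2 * F_upto L * (1 - real L * (1 / real (period * n))) * once_loop L (period * n) + (F_upto L)\<^sup>2
      < \<kappa> / 2 * \<delta>\<^sup>2) sequentially"
    using \<kappa> \<delta> by (intro order_tendstoD(2)) auto
  have ev_n: "eventually (\<lambda>n. (1 + real L) / \<delta> \<le> real (period * n)) sequentially"
    using period_times_at_top unfolding filterlim_at_top by blast
  show "eventually (\<lambda>n. ?prob n < \<kappa>) sequentially"
    using ev_V ev_n ev_sup eventually_u_pos
  proof eventually_elim
    case (elim n)
    let ?n = "period * n"
    have small: "1 + real L \<le> \<delta> * ?n" using elim(2) \<delta>(1) by (simp add: field_simps)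
    moreover have "\<delta> * real ?n \<le> 1 * real ?n" using \<delta>(2) by (intro mult_right_mono) auto
    ultimately have Ln: "L < ?n" by linarith
    have V: "?V ?n < \<kappa> / 2 * \<delta>\<^sup>2"
    proof -
      have "(real ?n - real L) / ?n = 1 - real L * (1 / real ?n)" using gr_implies_not0[OF Ln] by (simp add: diff_divide_distrib del: of_nat_mult)
      then show ?thesis using elim(1) by (simp del: of_nat_mult)
    qed
    have C: "u (?n - r) \<le> C * \<rho> ^ r * u ?n"
      if "1 \<le> r" "real r < (1 - \<delta>) * ?n" "period dvd r" for r
    proof -
      have "ereal (u (?n - r) / (\<rho> ^ r * u ?n)) \<le> ?sup ?n"
        using that by (intro SUP_upper) auto
      also have "\<dots> < ereal C0" by fact
      finally have "u (?n - r) / (\<rho> ^ r * u ?n) \<le> C" by (simp add: C_def)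
      moreover have "\<rho> ^ r * u ?n > 0" using rho_ge_1 elim(4) by simp
      ultimately show ?thesis by (simp add: divide_le_eq mult_ac)
    qed
    have "?prob n \<le> \<P>(\<omega> in M. \<bar>real (walk_range S ?n \<omega>) / real ?n - (1 - F_rho)\<bar> > 5 * \<delta> \<bar> S ?n \<omega> = e)"
    proof -
      have "(\<lambda>\<omega>. real (walk_range S ?n \<omega>)) \<in> borel_measurable M"
        unfolding walk_range_eq by measurable
      note this[measurable]
      show ?thesis unfolding cond_prob_def
        using \<delta>(3) by (intro divide_right_mono finite_measure_mono) (auto simp del: of_nat_mult)
    qed
    also have "\<dots> \<le> ?V ?n / \<delta>\<^sup>2 + C * (F_rho - F_upto L) / \<delta>"
    proof (rule bridge_deviation_bound[OF elim(4) L(1) Ln \<delta>(1) _ small _ C])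
      show "F_rho - F_upto L \<le> \<delta>" using L(2) by simp
      show "0 \<le> C" by (simp add: C_def)
    qed
    also have "?V ?n / \<delta>\<^sup>2 < \<kappa> / 2" using V \<delta>(1) by (simp add: divide_less_eq del: of_nat_mult)
    also have "C * (F_rho - F_upto L) / \<delta> \<le> \<kappa> / 2"
    proof -
      have "C * (F_rho - F_upto L) \<le> C * (\<kappa> * \<delta> / (2 * C))" using L(2) by (intro mult_left_mono) (auto simp: C_def)
      also have "\<dots> = \<kappa> / 2 * \<delta>" by (simp add: C_def)
      finally show ?thesis using \<delta>(1) by (simp add: divide_le_eq)
    qed
    finally show ?case by simp
  qed
qed

end

section \<open>Random walk on a vertex transitive graph\<close>

lemma (in simple_random_walk) graph_walk_transitive:
  "transitive_walk M V (\<lambda>x. pmf_of_set {w. adj x w}) e S"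
proof -
  have neighbours: "finite {w. adj x w}" "{w. adj x w} \<noteq> {}" "{w. adj x w} \<subseteq> V"
    if x: "x \<in> V" for x
  proof -
    show "finite {w. adj x w}" by (rule finite_neighbours[OF x])
    have "\<not> V \<subseteq> {x}" using infinite_vertices finite_subset by blast
    then obtain w where "w \<in> V" "w \<noteq> x" by blast
    then show "{w. adj x w} \<noteq> {}"
      using connected_graph[OF x] by (blast elim: converse_rtranclpE)
    show "{w. adj x w} \<subseteq> V" using adj_closed by blast
  qed
  have pmf_K: "pmf (pmf_of_set {w. adj x w}) y = (if adj x y then 1 / real D else 0)" if "x \<in> V" for x y
    using neighbours[OF that] degree[OF that] by (simp add: pmf_of_set)
  show ?thesis
  proof
    show "countable V" by (rule countable_vertices)
    show "e \<in> V" by (rule start_vertex)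
    show "set_pmf (pmf_of_set {w. adj x w}) \<subseteq> V" if "x \<in> V" for x
      using neighbours[OF that] by simp
    show "pmf (pmf_of_set {w. adj x w}) y = pmf (pmf_of_set {w. adj y w}) x" if "x \<in> V" "y \<in> V" for x y
      using that adj_sym by (auto simp: pmf_K)
    show "\<exists>\<phi>. inj_on \<phi> V \<and> \<phi> e = v \<and>
        (\<forall>x\<in>V. pmf_of_set {w. adj (\<phi> x) w} = map_pmf \<phi> (pmf_of_set {w. adj x w}))"
      if v: "v \<in> V" for v
    proof -
      obtain \<phi> where \<phi>: "bij_betw \<phi> V V" "\<phi> e = v"
        and adj: "\<And>x w. x \<in> V \<Longrightarrow> w \<in> V \<Longrightarrow> adj (\<phi> x) (\<phi> w) \<longleftrightarrow> adj x w"
        using vertex_transitive[OF start_vertex v] unfolding graph_automorphism_def by blast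
      have "pmf_of_set {w. adj (\<phi> x) w} = map_pmf \<phi> (pmf_of_set {w. adj x w})" if x: "x \<in> V" for x
      proof -
        have "{w. adj (\<phi> x) w} = \<phi> ` {w. adj x w}"
        proof (intro equalityI subsetI)
          fix w assume "w \<in> {w. adj (\<phi> x) w}"
          then have w: "adj (\<phi> x) w" by simp
          then have "w \<in> V" using adj_closed by blast
          then obtain w' where "w' \<in> V" "w = \<phi> w'" using \<phi>(1) by (auto simp: bij_betw_def)
          with w adj[OF x] show "w \<in> \<phi> ` {w. adj x w}" by blast
        next
          fix w assume "w \<in> \<phi> ` {w. adj x w}"
          then show "w \<in> {w. adj (\<phi> x) w}" using adj[OF x] adj_closed by blast
        qed
        moreover have "inj_on \<phi> {w. adj x w}"
          using \<phi>(1) neighbours(3)[OF x] by (auto simp: bij_betw_def intro: inj_on_subset)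
        ultimately show ?thesis
          using neighbours[OF x] by (simp add: map_pmf_of_set_inj)
      qed
      with \<phi> show ?thesis by (auto simp: bij_betw_def)
    qed
    show "S n \<in> measurable M (count_space V)" for n by (rule measurable_walk)
    show "AE \<omega> in M. S 0 \<omega> = e" by (rule start)
    show "\<P>(\<omega> in M. \<forall>k\<le>Suc n. S k \<omega> = h k) =
        \<P>(\<omega> in M. \<forall>k\<le>n. S k \<omega> = h k) * pmf (pmf_of_set {w. adj (h n) w}) (h (Suc n))"
      if h: "\<And>k. k \<le> Suc n \<Longrightarrow> h k \<in> V" for n h
    proof -
      have [measurable]: "S n \<in> measurable M (count_space UNIV)" for n
        using measurable_compose[OF measurable_walk, of id "count_space UNIV"] by simp
      have split: "\<P>(\<omega> in M. \<forall>k\<le>Suc n. S k \<omega> = h k) =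
          \<P>(\<omega> in M. S (Suc n) \<omega> = h (Suc n) \<and> (\<forall>k\<le>n. S k \<omega> = h k))"
        by (intro arg_cong[where f = prob]) (auto simp: le_Suc_eq)
      show ?thesis
      \<comment> \<open>For null histories both sides of the step equation vanish.\<close>
      proof (cases "\<P>(\<omega> in M. \<forall>k\<le>n. S k \<omega> = h k) > 0")
        case True
        have "\<P>(\<omega> in M. S (Suc n) \<omega> = h (Suc n) \<and> (\<forall>k\<le>n. S k \<omega> = h k))
          / \<P>(\<omega> in M. \<forall>k\<le>n. S k \<omega> = h k) = pmf (pmf_of_set {w. adj (h n) w}) (h (Suc n))"
          using markov[OF h[of "Suc n"] True] h[of n] by (simp add: cond_prob_def pmf_K)
        with True show ?thesis unfolding split by (simp add: field_simps)
      next
        case False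
        then have 0: "\<P>(\<omega> in M. \<forall>k\<le>n. S k \<omega> = h k) = 0" by (simp add: not_less measure_le_0_iff)
        have "\<P>(\<omega> in M. S (Suc n) \<omega> = h (Suc n) \<and> (\<forall>k\<le>n. S k \<omega> = h k))
            \<le> \<P>(\<omega> in M. \<forall>k\<le>n. S k \<omega> = h k)"
          by (intro finite_measure_mono) auto
        then have "\<P>(\<omega> in M. S (Suc n) \<omega> = h (Suc n) \<and> (\<forall>k\<le>n. S k \<omega> = h k)) = 0"
          unfolding 0 by (simp add: measure_le_0_iff)
        then show ?thesis unfolding split 0 by simp
      qed
    qed
  qed
qed

section \<open>Random walk on a finitely generated group\<close>

lemma (in group) countable_generate:
  assumes "H \<subseteq> carrier G" "countable H"
  shows "countable (generate G H)"
proof -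
  let ?A = "H \<union> m_inv G ` H"
  have closed: "foldr (\<otimes>) l \<one> \<in> carrier G" if "set l \<subseteq> carrier G" for l
    using that by (induction l) auto
  have append: "foldr (\<otimes>) (l @ l') \<one> = foldr (\<otimes>) l \<one> \<otimes> foldr (\<otimes>) l' \<one>"
    if "set l \<subseteq> carrier G" "set l' \<subseteq> carrier G" for l l'
    using that by (induction l) (auto simp: closed m_assoc)
  have A: "?A \<subseteq> carrier G" using assms(1) by auto
  have "generate G H \<subseteq> (\<lambda>l. foldr (\<otimes>) l \<one>) ` lists ?A"
  proof
    fix x assume "x \<in> generate G H"
    then show "x \<in> (\<lambda>l. foldr (\<otimes>) l \<one>) ` lists ?A"
    proof induction
      case one
      show ?case by (rule image_eqI[of _ _ "[]"]) auto
    next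
      case (incl h)
      then show ?case using assms(1) by (intro image_eqI[of _ _ "[h]"]) auto
    next
      case (inv h)
      then show ?case using assms(1) by (intro image_eqI[of _ _ "[inv h]"]) auto
    next
      case (eng h1 h2)
      then obtain l1 l2 where l: "l1 \<in> lists ?A" "h1 = foldr (\<otimes>) l1 \<one>"
        "l2 \<in> lists ?A" "h2 = foldr (\<otimes>) l2 \<one>" by blast
      then have "set l1 \<subseteq> carrier G" "set l2 \<subseteq> carrier G" using A by blast+
      with l show ?case by (intro image_eqI[of _ _ "l1 @ l2"]) (auto simp: append simp del: foldr_append)
    qed
  qed
  moreover have "countable (lists ?A)" using assms(2) by (intro countable_lists) auto
  ultimately show ?thesis by (auto intro: countable_subset)
qed

context symmetric_group_steps
begin

lemma countable_carrier: "countable (carrier G)"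
proof -
  have "countable (generate G (g ` {1..s} \<union> (\<lambda>i. inv (g i)) ` {1..s}))"
    using generators_closed by (intro countable_generate) (auto intro!: uncountable_infinite)
  then show ?thesis unfolding generating .
qed

lemma step_measurable: "n \<ge> 1 \<Longrightarrow> X n \<in> measurable M (count_space (carrier G))"
  using steps_indep by (simp add: indep_vars_def)

lemma step_closed: "n \<ge> 1 \<Longrightarrow> \<omega> \<in> space M \<Longrightarrow> X n \<omega> \<in> carrier G"
  using measurable_space[OF step_measurable] by simp

lemma walk_measurable: "right_walk G X n \<in> measurable M (count_space (carrier G))"
proof (induction n)
  case (Suc n)
  have "(\<lambda>\<omega>. b \<otimes> X (Suc n) \<omega>) \<in> measurable M (count_space (carrier G))" if "b \<in> carrier G" for b
    using that by (intro measurable_compose[OF step_measurable]) auto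
  from measurable_compose_countable'[OF this Suc countable_carrier] show ?case by simp
qed simp

text \<open>
  The common law of the steps is taken from the first step; it is a discrete distribution because
  the group is countable.
\<close>

definition step_pmf :: "'v pmf" where
  "step_pmf = Abs_pmf (distr M (count_space UNIV) (X 1))"

lemma step_measurable_UNIV: "n \<ge> 1 \<Longrightarrow> X n \<in> measurable M (count_space UNIV)"
  using measurable_compose[OF step_measurable, of n id "count_space UNIV"] by simp

lemma pmf_step_pmf: "pmf step_pmf x = \<P>(\<omega> in M. X 1 \<omega> = x)"
proof -
  let ?Q = "distr M (count_space UNIV) (X 1)"
  interpret Q: prob_space ?Q by (rule prob_space_distr[OF step_measurable_UNIV]) simp
  have "AE x in ?Q. x \<in> carrier G"
    using step_closed by (subst AE_distr_iff[OF step_measurable_UNIV]) auto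
  then have "AE x in ?Q. measure ?Q {x} \<noteq> 0"
    using countable_carrier by (subst Q.AE_support_countable) auto
  then have "measure_pmf step_pmf = ?Q"
    unfolding step_pmf_def using Q.prob_space_axioms
    by (intro Abs_pmf_inverse) (simp del: One_nat_def)
  then have "pmf step_pmf x = measure ?Q {x}" by (simp add: pmf.rep_eq)
  also have "\<dots> = prob (X 1 -` {x} \<inter> space M)"
    by (rule measure_distr[OF step_measurable_UNIV]) auto
  also have "X 1 -` {x} \<inter> space M = {\<omega> \<in> space M. X 1 \<omega> = x}" by blast
  finally show ?thesis .
qed

lemma prob_step: "n \<ge> 1 \<Longrightarrow> x \<in> carrier G \<Longrightarrow> \<P>(\<omega> in M. X n \<omega> = x) = pmf step_pmf x"
  using steps_law[of n x] steps_law[of 1 x] by (simp add: pmf_step_pmf)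

lemma set_step_pmf: "set_pmf step_pmf \<subseteq> carrier G"
proof
  fix x assume "x \<in> set_pmf step_pmf"
  then have "\<P>(\<omega> in M. X 1 \<omega> = x) \<noteq> 0" by (simp add: set_pmf_iff pmf_step_pmf)
  then have "{\<omega> \<in> space M. X 1 \<omega> = x} \<noteq> {}" by (metis measure_empty)
  then show "x \<in> carrier G" using step_closed by auto
qed

text \<open>
  Passing to inverses exchanges the roles of the generators and their inverses, and the weights of
  the two are the same.
\<close>

lemma step_pmf_inv: assumes "x \<in> carrier G" shows "pmf step_pmf (inv x) = pmf step_pmf x"
proof -
  have law: "pmf step_pmf y = (\<Sum>i | i \<in> {1..s} \<and> g i = y. \<alpha> i) + (\<Sum>i | i \<in> {1..s} \<and> inv (g i) = y. \<alpha> i)"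
    if "y \<in> carrier G" for y
    using steps_law[of 1 y] that weights_sym by (simp add: pmf_step_pmf)
  have gi: "g i \<in> carrier G" if "i \<in> {1..s}" for i using generators_closed that by blast
  have "inv (g i) = inv x \<longleftrightarrow> g i = x" "g i = inv x \<longleftrightarrow> inv (g i) = x" if "i \<in> {1..s}" for i
    using gi[OF that] assms by (metis inv_inv)+
  then have "{i. i \<in> {1..s} \<and> g i = inv x} = {i. i \<in> {1..s} \<and> inv (g i) = x}"
    "{i. i \<in> {1..s} \<and> inv (g i) = inv x} = {i. i \<in> {1..s} \<and> g i = x}"
    by blast+
  then show ?thesis using assms by (simp add: law add.commute)
qed

definition walk_kernel :: "'v \<Rightarrow> 'v pmf" where
  "walk_kernel x = map_pmf (\<lambda>y. x \<otimes> y) step_pmf"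

lemma pmf_walk_kernel:
  assumes "x \<in> carrier G" "y \<in> carrier G"
  shows "pmf (walk_kernel x) y = pmf step_pmf (inv x \<otimes> y)"
proof -
  have "pmf (walk_kernel x) y = measure_pmf.prob step_pmf ((\<lambda>z. x \<otimes> z) -` {y})"
    by (simp add: walk_kernel_def pmf_map)
  also have "\<dots> = measure_pmf.prob step_pmf {inv x \<otimes> y}"
  proof (intro measure_pmf.finite_measure_eq_AE AE_pmfI)
    fix z assume "z \<in> set_pmf step_pmf"
    then have z: "z \<in> carrier G" using set_step_pmf by blast
    have "x \<otimes> z = y \<longleftrightarrow> z = inv x \<otimes> y"
      using assms z by (metis inv_solve_left)
    then show "z \<in> (\<lambda>z. x \<otimes> z) -` {y} \<longleftrightarrow> z \<in> {inv x \<otimes> y}" by simp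
  qed simp_all
  finally show ?thesis by (simp add: measure_pmf_single)
qed

text \<open>
  Prescribing the positions is the same as prescribing the increments, and the latter are
  independent.
\<close>

lemma walk_path_iff_steps:
  assumes "\<omega> \<in> space M" "\<And>k. k \<le> n \<Longrightarrow> h k \<in> carrier G"
  shows "(\<forall>k\<le>n. right_walk G X k \<omega> = h k) \<longleftrightarrow>
    h 0 = \<one> \<and> (\<forall>k\<in>{1..n}. X k \<omega> = inv (h (k - 1)) \<otimes> h k)"
  using assms(2)
proof (induction n)
  case (Suc n)
  have hn: "h n \<in> carrier G" "h (Suc n) \<in> carrier G" using Suc.prems by auto
  have X: "X (Suc n) \<omega> \<in> carrier G" using step_closed assms(1) by auto
  have last: "h n \<otimes> X (Suc n) \<omega> = h (Suc n) \<longleftrightarrow> X (Suc n) \<omega> = inv (h n) \<otimes> h (Suc n)"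
    using hn X by (metis inv_solve_left)
  have "(\<forall>k\<le>Suc n. right_walk G X k \<omega> = h k) \<longleftrightarrow>
      (\<forall>k\<le>n. right_walk G X k \<omega> = h k) \<and> right_walk G X (Suc n) \<omega> = h (Suc n)"
    by (auto simp: le_Suc_eq simp del: right_walk.simps)
  also have "\<dots> \<longleftrightarrow> (\<forall>k\<le>n. right_walk G X k \<omega> = h k) \<and> h n \<otimes> X (Suc n) \<omega> = h (Suc n)"
    by (intro conj_cong refl) simp
  also have "\<dots> \<longleftrightarrow> h 0 = \<one> \<and> (\<forall>k\<in>{1..Suc n}. X k \<omega> = inv (h (k - 1)) \<otimes> h k)"
    using Suc by (auto simp: last atLeastAtMostSuc_conv)
  finally show ?case .
qed auto

lemma prob_walk_path:
  assumes h: "\<And>k. k \<le> n \<Longrightarrow> h k \<in> carrier G"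
  shows "\<P>(\<omega> in M. \<forall>k\<le>n. right_walk G X k \<omega> = h k) =
    (if h 0 = \<one> then \<Prod>k = 1..n. pmf step_pmf (inv (h (k - 1)) \<otimes> h k) else 0)"
proof -
  let ?a = "\<lambda>k. inv (h (k - 1)) \<otimes> h k"
  have eq: "{\<omega> \<in> space M. \<forall>k\<le>n. right_walk G X k \<omega> = h k} =
      {\<omega> \<in> space M. h 0 = \<one> \<and> (\<forall>k\<in>{1..n}. X k \<omega> = ?a k)}"
    by (intro Collect_cong conj_cong refl walk_path_iff_steps h)
  have "prob {\<omega> \<in> space M. \<forall>k\<in>{1..n}. X k \<omega> = ?a k} = (\<Prod>k = 1..n. pmf step_pmf (?a k))"
  proof (cases "n = 0")
    case False
    have "{\<omega> \<in> space M. \<forall>k\<in>{1..n}. X k \<omega> = ?a k} = (\<Inter>k\<in>{1..n}. X k -` {?a k} \<inter> space M)"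
      using False by auto
    also have "prob \<dots> = (\<Prod>k = 1..n. prob (X k -` {?a k} \<inter> space M))"
      using False h by (intro indep_varsD[OF steps_indep]) auto
    also have "\<dots> = (\<Prod>k = 1..n. pmf step_pmf (?a k))"
    proof (intro prod.cong refl)
      fix k assume "k \<in> {1..n}"
      then have "\<P>(\<omega> in M. X k \<omega> = ?a k) = pmf step_pmf (?a k)" using h by (intro prob_step) auto
      moreover have "X k -` {?a k} \<inter> space M = {\<omega> \<in> space M. X k \<omega> = ?a k}" by blast
      ultimately show "prob (X k -` {?a k} \<inter> space M) = pmf step_pmf (?a k)" by simp
    qed
    finally show ?thesis .
  qed (simp add: prob_space)
  then show ?thesis unfolding eq by simp
qed

text \<open>
  Left translations commute with right multiplication by the steps, so they preserve the kernel,
  and they act transitively.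
\<close>

lemma group_walk_transitive:
  "transitive_walk M (carrier G) walk_kernel \<one> (right_walk G X)"
proof
  show "countable (carrier G)" by (rule countable_carrier)
  show "\<one> \<in> carrier G" by (rule one_closed)
  show "set_pmf (walk_kernel x) \<subseteq> carrier G" if "x \<in> carrier G" for x
    using that set_step_pmf by (auto simp: walk_kernel_def)
  show "pmf (walk_kernel x) y = pmf (walk_kernel y) x" if "x \<in> carrier G" "y \<in> carrier G" for x y
    using that step_pmf_inv[of "inv y \<otimes> x"] by (simp add: pmf_walk_kernel inv_mult_group)
  show "\<exists>\<phi>. inj_on \<phi> (carrier G) \<and> \<phi> \<one> = v \<and>
      (\<forall>x\<in>carrier G. walk_kernel (\<phi> x) = map_pmf \<phi> (walk_kernel x))" if v: "v \<in> carrier G" for v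
  proof (intro exI[of _ "\<lambda>x. v \<otimes> x"] conjI ballI)
    show "inj_on (\<lambda>x. v \<otimes> x) (carrier G)" using v by (auto simp: inj_on_def)
    show "v \<otimes> \<one> = v" using v by simp
    show "walk_kernel (v \<otimes> x) = map_pmf (\<lambda>x. v \<otimes> x) (walk_kernel x)" if "x \<in> carrier G" for x
      unfolding walk_kernel_def pmf.map_comp
      using that v set_step_pmf by (intro map_pmf_cong) (auto simp: m_assoc)
  qed
  show "right_walk G X n \<in> measurable M (count_space (carrier G))" for n by (rule walk_measurable)
  show "AE \<omega> in M. right_walk G X 0 \<omega> = \<one>" by simp
  show "\<P>(\<omega> in M. \<forall>k\<le>Suc n. right_walk G X k \<omega> = h k) =
      \<P>(\<omega> in M. \<forall>k\<le>n. right_walk G X k \<omega> = h k) * pmf (walk_kernel (h n)) (h (Suc n))"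
    if h: "\<And>k. k \<le> Suc n \<Longrightarrow> h k \<in> carrier G" for n h
    using h by (simp add: prob_walk_path pmf_walk_kernel)
qed

end

section \<open>The range of the random walk bridge\<close>

theorem theorem3:
  fixes M :: "'w measure" and S :: "nat \<Rightarrow> 'w \<Rightarrow> 'v" and e :: 'v
    and V :: "'v set" and adj :: "'v \<Rightarrow> 'v \<Rightarrow> bool" and D :: nat
    and G :: "('v, 'm) monoid_scheme" and s :: nat and g :: "nat \<Rightarrow> 'v"
    and \<alpha> :: "nat \<Rightarrow> real" and X :: "nat \<Rightarrow> 'w \<Rightarrow> 'v"
    and u f :: "nat \<Rightarrow> real" and p :: nat and \<rho> :: real and F :: "real \<Rightarrow> real"
  assumes walk:
    "simple_random_walk M V adj D e S \<or>
     (symmetric_group_steps M G s g \<alpha> X \<and> S = right_walk G X \<and> e = \<one>\<^bsub>G\<^esub>)"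
  defines "u \<equiv> return_prob M S e"
    and "f \<equiv> first_return_prob M S e"
    and "p \<equiv> walk_period M S e"
    and "\<rho> \<equiv> real_of_ereal (conv_radius u)"
    and "F \<equiv> \<lambda>z. \<Sum>n. f (Suc n) * z ^ Suc n"
  shows
    "1 \<le> conv_radius u \<and> conv_radius u < \<infinity> \<and>
     (\<lambda>n. u (p * n) powr (1 / real (p * n))) \<longlonglongrightarrow> 1 / \<rho> \<and>
     summable (\<lambda>n. f (Suc n) * \<rho> ^ Suc n) \<and> F \<rho> \<le> 1 \<and>
     ((\<forall>\<eta>::real. 0 < \<eta> \<and> \<eta> < 1 \<longrightarrow>
         Limsup (multiples_at_top p)
           (\<lambda>n. SUP r \<in> {r. 1 \<le> r \<and> real r < (1 - \<eta>) * real n \<and> p dvd r}.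
                  ereal (u (n - r) / (\<rho> ^ r * u n))) < \<infinity>) \<and>
      (\<forall>r. p dvd r \<longrightarrow>
         ((\<lambda>n. u (n - r) / (\<rho> ^ r * u n)) \<longlongrightarrow> 1) (multiples_at_top p)) \<longrightarrow>
      (\<forall>\<epsilon>>0.
         (\<lambda>n. \<P>(\<omega> in M. \<bar>real (walk_range S (p * n) \<omega>) / real (p * n) - (1 - F \<rho>)\<bar> > \<epsilon>
                  \<bar> S (p * n) \<omega> = e)) \<longlonglongrightarrow> 0))"
proof -
  from walk have "\<exists>V' K. transitive_walk M V' K e S"
  proof (elim disjE conjE)
    assume "simple_random_walk M V adj D e S"
    then show ?thesis by (intro exI) (rule simple_random_walk.graph_walk_transitive)
  next
    assume "symmetric_group_steps M G s g \<alpha> X" "S = right_walk G X" "e = \<one>\<^bsub>G\<^esub>"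
    then show ?thesis
      by (simp only:) (intro exI, rule symmetric_group_steps.group_walk_transitive)
  qed
  then obtain V' K where "transitive_walk M V' K e S" by blast
  then interpret W: transitive_walk M V' K e S .
  have rho: "\<rho> = W.\<rho>" and F: "F \<rho> = W.F_rho" and p: "p = W.period"
    by (simp_all add: \<rho>_def W.\<rho>_def u_def f_def F_def W.F_rho_def p_def W.period_eq)
  show ?thesis
    unfolding F unfolding rho p unfolding u_def f_def
    by (intro conjI impI allI W.one_le_conv_radius W.conv_radius_finite W.u_root_tendsto
        W.F_summable W.F_rho_le_1; elim conjE; rule W.bridge_range_tendsto)
qed

end
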